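(* Let $\mathcal A(\varLambda,B)$ be the quantum cluster algebra of $\mathbb P^1$. Each one of the following three sets is a $\mathbb Z[\nu^{\pm1}]$-basis of $\mathcal A(\varLambda,B)$ consisting of bar-invariant elements: $$\mathbb B_1^{tor}\cup\bar{\mathbb B}^{vet},\qquad \mathbb B_2^{tor}\cup\bar{\mathbb B}^{vet},\qquad \mathbb B_3^{tor}\cup\bar{\mathbb B}^{vet}.$$
   Context: Let $\nu$ be a formal variable and $\varLambda=\begin{bmatrix}0&-1\\1&0\end{bmatrix}$, $\varLambda(\alpha,\beta)=\alpha^t\varLambda\beta$. $\hat{\mathcal T}_\varLambda$ is the $\mathbb Z[\nu^{\pm1}]$-algebra of formal sums $\sum_{\alpha\in\mathbb Z^2}c_\alpha X^\alpha$ whose support is bounded above in both coordinates, with product $X^\alpha X^\beta=\nu^{\varLambda(\alpha,\beta)}X^{\alpha+\beta}$. Write $X^{(a,b)}$ for $X^{\alpha}$ with $\alpha=(a,b)^t$, and $[n]_{\nu^4}=(\nu^{4n}-1)/(\nu^4-1)$. For $l\in\mathbb Z$, $$X_{\mathcal O(l)}=X^{-(l+1,-1)}+\sum_{r\ge -l}\nu^{-2(l+r)}[l+r+1]_{\nu^4}\,X^{-(l+2r+1,1)}.$$ $\mathcal A(\varLambda,B)$, with $B=\begin{bmatrix}0&-2\\2&0\end{bmatrix}$, is the $\mathbb Z[\nu^{\pm1}]$-subalgebra of $\hat{\mathcal T}_\varLambda$ generated by $X_{\mathcal O(l)}$, $l\in\mathbb Z$. The bar-involution is the additive anti-automorphism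 of $\hat{\mathcal T}_\varLambda$ (so $\overline{xy}=\bar y\,\bar x$) with $\overline{\nu^{\pm1}}=\nu^{\mp1}$ and $\overline{X^\alpha}=X^\alpha$; an element $x$ is bar-invariant if $\bar x=x$. $X_{n\delta}=X^{-(n,0)}+X^{(n,0)}$ for $n\ge1$, $X_{0\delta}=1$, $X_\delta=X_{1\delta}$; $X_{E_x^{(n)}}=\sum_{l=0}^nX^{-(n-2l,0)}$ for $n\ge0$. The sets are $\mathbb B_1^{tor}=\{X_{r\delta}\mid r\in\mathbb N\}$, $\mathbb B_2^{tor}=\{X_\delta^r\mid r\in\mathbb N\}$, $\mathbb B_3^{tor}=\{X_{E_x^{(r)}}\mid r\in\mathbb N\}$ (with $0\in\mathbb N$), and $$\bar{\mathbb B}^{vet}=\bigcup_{r\ge1}\{\nu^{d(r-d)}X_{\mathcal O(l)}^dX_{\mathcal O(l+1)}^{r-d}\mid l\in\mathbb Z,\ 1\le d\le r\}.$$ *)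

theory Defs
  imports Complex_Main "HOL-Library.Poly_Mapping" "HOL-Library.Product_Plus"
begin

section \<open>Laurent polynomials in one variable over the integers\<close>

text \<open>The group ring of the additive group of integers; the product of \<^typ>\<open>int \<Rightarrow>\<^sub>0 int\<close>
  is convolution, and \<open>nu_pow k\<close> is \<open>\<nu>\<^sup>k\<close>.\<close>

type_synonym laurent = "int \<Rightarrow>\<^sub>0 int"

definition nu_pow :: "int \<Rightarrow> laurent"
  where "nu_pow k = Poly_Mapping.single k 1"

lemma nu_pow_0 [simp]: "nu_pow 0 = 1"
  by (simp add: nu_pow_def)

lemma nu_pow_add: "nu_pow (j + k) = nu_pow j * nu_pow k"
  by (simp add: nu_pow_def mult_single)

lemma nu_pow_eq_iff [simp]: "nu_pow j = nu_pow k \<longleftrightarrow> j = k"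
  by (auto simp: nu_pow_def dest: arg_cong[where f = Poly_Mapping.keys])

lemma nu_pow_nonzero [simp]: "nu_pow k \<noteq> 0"
  by (metis keys_eq_empty keys_single nu_pow_def insert_not_empty zero_neq_one)

definition laurent_bar :: "laurent \<Rightarrow> laurent"
  where "laurent_bar = Poly_Mapping.map_key uminus"

lemma lookup_laurent_bar: "Poly_Mapping.lookup (laurent_bar p) k = Poly_Mapping.lookup p (- k)"
  by (simp add: laurent_bar_def map_key.rep_eq inj_def)

lemma laurent_bar_0 [simp]: "laurent_bar 0 = 0"
  by (rule poly_mapping_eqI) (simp add: lookup_laurent_bar)

lemma laurent_bar_add [simp]: "laurent_bar (p + q) = laurent_bar p + laurent_bar q"
  by (rule poly_mapping_eqI) (simp add: lookup_laurent_bar lookup_add)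

lemma laurent_bar_single: "laurent_bar (Poly_Mapping.single k c) = Poly_Mapping.single (- k) c"
  by (rule poly_mapping_eqI) (auto simp: lookup_laurent_bar lookup_single when_def)

lemma laurent_bar_nu_pow [simp]: "laurent_bar (nu_pow k) = nu_pow (- k)"
  by (simp add: nu_pow_def laurent_bar_single)

lemma laurent_bar_one [simp]: "laurent_bar 1 = 1"
  using laurent_bar_nu_pow[of 0] by simp

lemma laurent_bar_bar [simp]: "laurent_bar (laurent_bar p) = p"
  by (rule poly_mapping_eqI) (simp add: lookup_laurent_bar)

lemma laurent_bar_eq_0_iff [simp]: "laurent_bar p = 0 \<longleftrightarrow> p = 0"
  by (metis laurent_bar_bar laurent_bar_0)

lemma laurent_bar_sum: "laurent_bar (sum f A) = (\<Sum>a\<in>A. laurent_bar (f a))"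
  by (induction A rule: infinite_finite_induct) auto

lemma laurent_induct [case_names zero add]:
  assumes "P 0" and "\<And>p k c. P p \<Longrightarrow> P (p + Poly_Mapping.single k c)"
  shows "P (p :: laurent)"
proof (induction p rule: update_induct)
  case const
  then show ?case by (rule assms(1))
next
  case (update f a b)
  then have "Poly_Mapping.update a b f = f + Poly_Mapping.single a b"
    by (intro poly_mapping_eqI)
       (auto simp: lookup_update lookup_add lookup_single when_def in_keys_iff)
  then show ?case using assms(2) update by simp
qed

lemma laurent_bar_mult [simp]: "laurent_bar (p * q) = laurent_bar p * laurent_bar q"
proof (induction p rule: laurent_induct)
  case (add p k c)
  have "laurent_bar (Poly_Mapping.single k c * q)
      = laurent_bar (Poly_Mapping.single k c) * laurent_bar q"
    by (induction q rule: laurent_induct)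
       (simp_all add: distrib_left mult_single laurent_bar_single)
  with add show ?case by (simp add: distrib_right)
qed simp

text \<open>The quantum integer in the variable \<open>\<nu>\<^sup>4\<close>, i.e. the exact quotient of
  \<open>\<nu>\<^bsup>4n\<^esup> - 1\<close> by \<open>\<nu>\<^sup>4 - 1\<close>.\<close>

definition qint :: "int \<Rightarrow> laurent"
  where "qint n = (THE q. q * (nu_pow 4 - 1) = nu_pow (4 * n) - 1)"

lemma qint_eqI:
  assumes "q * (nu_pow 4 - 1) = nu_pow (4 * n) - 1"
  shows "qint n = q"
proof -
  have "nu_pow 4 - 1 \<noteq> 0"
    using nu_pow_eq_iff[of 4 0] by (simp del: nu_pow_eq_iff)
  then show ?thesis
    unfolding qint_def using assms by (intro the_equality) (metis mult_right_cancel)+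
qed

lemma geometric_sum_nu_pow:
  "(\<Sum>k<n. nu_pow (4 * int k)) * (nu_pow 4 - 1) = nu_pow (4 * int n) - 1"
proof (induction n)
  case (Suc n)
  have "nu_pow (4 * int (Suc n)) = nu_pow (4 * int n) * nu_pow 4"
    by (simp add: algebra_simps flip: nu_pow_add)
  with Suc show ?case
    by (simp add: algebra_simps)
qed simp

lemma qint_of_nat: "qint (int n) = (\<Sum>k<n. nu_pow (4 * int k))"
  by (rule qint_eqI) (rule geometric_sum_nu_pow)

lemma qint_quotient: "n \<ge> 0 \<Longrightarrow> qint n * (nu_pow 4 - 1) = nu_pow (4 * n) - 1"
  using geometric_sum_nu_pow[of "nat n"] qint_of_nat[of "nat n"] by simp


section \<open>The completed quantum torus\<close>

type_synonym expo = "int \<times> int"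

text \<open>\<open>\<alpha>\<^sup>t \<Lambda> \<beta>\<close> for the matrix \<open>\<Lambda>\<close> with rows \<open>(0, -1)\<close> and \<open>(1, 0)\<close>.\<close>

definition Lam :: "expo \<Rightarrow> expo \<Rightarrow> int"
  where "Lam \<alpha> \<beta> = snd \<alpha> * fst \<beta> - fst \<alpha> * snd \<beta>"

lemma Lam_simps [simp]: "Lam 0 \<alpha> = 0" "Lam \<alpha> 0 = 0" "Lam \<alpha> \<alpha> = 0"
  by (simp_all add: Lam_def)

typedef qtorus = "{f :: expo \<Rightarrow> laurent. \<exists>a b. \<forall>\<alpha>. f \<alpha> \<noteq> 0 \<longrightarrow> fst \<alpha> \<le> a \<and> snd \<alpha> \<le> b}"
  morphisms coeff Abs_qtorus
  by (rule exI[of _ "\<lambda>_. 0"]) simp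

setup_lifting type_definition_qtorus
lifting_forget poly_mapping.lifting

lemma qtorus_eqI: "(\<And>\<alpha>. coeff f \<alpha> = coeff g \<alpha>) \<Longrightarrow> f = g"
  by (metis coeff_inject ext)

definition box :: "expo \<Rightarrow> expo \<Rightarrow> expo set"
  where "box \<alpha> \<beta> = {fst \<alpha>..fst \<beta>} \<times> {snd \<alpha>..snd \<beta>}"

lemma finite_box [simp]: "finite (box \<alpha> \<beta>)"
  by (simp add: box_def)

lemma in_box: "\<gamma> \<in> box \<alpha> \<beta> \<longleftrightarrow>
    fst \<alpha> \<le> fst \<gamma> \<and> snd \<alpha> \<le> snd \<gamma> \<and> fst \<gamma> \<le> fst \<beta> \<and> snd \<gamma> \<le> snd \<beta>"
  by (cases \<gamma>) (auto simp: box_def)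

definition bounded_by :: "expo \<Rightarrow> (expo \<Rightarrow> laurent) \<Rightarrow> bool"
  where "bounded_by N f \<longleftrightarrow> (\<forall>\<alpha>. f \<alpha> \<noteq> 0 \<longrightarrow> fst \<alpha> \<le> fst N \<and> snd \<alpha> \<le> snd N)"

lemma bounded_by_coeff: "\<exists>N. bounded_by N (coeff f)"
  using coeff[of f] by (auto simp: bounded_by_def)

text \<open>The coefficient of \<open>X\<^sup>\<gamma>\<close> in the product is
  \<open>\<Sum> \<nu>\<^bsup>\<Lambda>(\<alpha>, \<beta>)\<^esup> f\<^sub>\<alpha> g\<^sub>\<beta>\<close> over all \<open>\<alpha> + \<beta> = \<gamma>\<close>;
  only finitely many summands are nonzero.\<close>

definition qmult :: "(expo \<Rightarrow> laurent) \<Rightarrow> (expo \<Rightarrow> laurent) \<Rightarrow> expo \<Rightarrow> laurent"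
  where "qmult f g \<gamma> =
    (\<Sum>(\<alpha>, \<beta>) | \<alpha> + \<beta> = \<gamma> \<and> f \<alpha> \<noteq> 0 \<and> g \<beta> \<noteq> 0. nu_pow (Lam \<alpha> \<beta>) * f \<alpha> * g \<beta>)"

lemma qmult_eq:
  assumes "finite S" "{\<alpha>. f \<alpha> \<noteq> 0 \<and> g (\<gamma> - \<alpha>) \<noteq> 0} \<subseteq> S"
  shows "qmult f g \<gamma> = (\<Sum>\<alpha>\<in>S. nu_pow (Lam \<alpha> (\<gamma> - \<alpha>)) * f \<alpha> * g (\<gamma> - \<alpha>))"
proof -
  have "qmult f g \<gamma>
      = (\<Sum>\<alpha> | f \<alpha> \<noteq> 0 \<and> g (\<gamma> - \<alpha>) \<noteq> 0. nu_pow (Lam \<alpha> (\<gamma> - \<alpha>)) * f \<alpha> * g (\<gamma> - \<alpha>))"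
    unfolding qmult_def
    by (rule sum.reindex_bij_witness[of _ "\<lambda>\<alpha>. (\<alpha>, \<gamma> - \<alpha>)" fst]) auto
  also have "\<dots> = (\<Sum>\<alpha>\<in>S. nu_pow (Lam \<alpha> (\<gamma> - \<alpha>)) * f \<alpha> * g (\<gamma> - \<alpha>))"
    using assms by (intro sum.mono_neutral_left) auto
  finally show ?thesis .
qed

lemma bounded_by_box:
  assumes "bounded_by M f" "bounded_by N g"
  shows "{\<alpha>. f \<alpha> \<noteq> 0 \<and> g (\<gamma> - \<alpha>) \<noteq> 0} \<subseteq> box (\<gamma> - N) M"
proof
  fix \<alpha> assume "\<alpha> \<in> {\<alpha>. f \<alpha> \<noteq> 0 \<and> g (\<gamma> - \<alpha>) \<noteq> 0}"
  then have "fst \<alpha> \<le> fst M \<and> snd \<alpha> \<le> snd M"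
    and "fst (\<gamma> - \<alpha>) \<le> fst N \<and> snd (\<gamma> - \<alpha>) \<le> snd N"
    using assms unfolding bounded_by_def by blast+
  then show "\<alpha> \<in> box (\<gamma> - N) M" by (simp add: in_box)
qed

lemma qmult_eq_box:
  assumes "bounded_by M f" "bounded_by N g"
  shows "qmult f g \<gamma>
    = (\<Sum>\<alpha>\<in>box (\<gamma> - N) M. nu_pow (Lam \<alpha> (\<gamma> - \<alpha>)) * f \<alpha> * g (\<gamma> - \<alpha>))"
  by (rule qmult_eq) (simp_all only: finite_box bounded_by_box[OF assms])

lemma bounded_by_qmult:
  assumes "bounded_by M f" "bounded_by N g"
  shows "bounded_by (M + N) (qmult f g)"
  unfolding bounded_by_def
proof (intro allI impI)
  fix \<gamma> assume "qmult f g \<gamma> \<noteq> 0"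
  then obtain p where "p \<in> {(\<alpha>, \<beta>). \<alpha> + \<beta> = \<gamma> \<and> f \<alpha> \<noteq> 0 \<and> g \<beta> \<noteq> 0}"
    unfolding qmult_def by (metis (mono_tags, lifting) sum.neutral ex_in_conv empty_iff)
  then show "fst \<gamma> \<le> fst (M + N) \<and> snd \<gamma> \<le> snd (M + N)"
    using assms by (auto simp: bounded_by_def intro!: add_mono)
qed

lemma qmult_assoc:
  assumes f: "bounded_by K f" and g: "bounded_by M g" and h: "bounded_by N h"
  shows "qmult (qmult f g) h \<gamma> = qmult f (qmult g h) \<gamma>"
proof -
  let ?A = "box (\<gamma> - M - N) K" and ?B = "box (\<gamma> - N) (K + M)"
  have fg: "bounded_by (K + M) (qmult f g)" and gh: "bounded_by (M + N) (qmult g h)"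
    using assms by (auto intro: bounded_by_qmult)
  have inner1: "qmult f g \<mu> = (\<Sum>\<alpha>\<in>?A. nu_pow (Lam \<alpha> (\<mu> - \<alpha>)) * f \<alpha> * g (\<mu> - \<alpha>))"
    if "\<mu> \<in> ?B" for \<mu>
  proof (rule qmult_eq)
    have "box (\<mu> - M) K \<subseteq> ?A"
      using that by (auto simp: in_box)
    with bounded_by_box[OF f g, of \<mu>]
    show "{\<alpha>. f \<alpha> \<noteq> 0 \<and> g (\<mu> - \<alpha>) \<noteq> 0} \<subseteq> ?A" by (rule subset_trans)
  qed simp
  have inner2: "qmult g h (\<gamma> - \<alpha>)
      = (\<Sum>\<mu>\<in>?B. nu_pow (Lam (\<mu> - \<alpha>) (\<gamma> - \<mu>)) * g (\<mu> - \<alpha>) * h (\<gamma> - \<mu>))"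
    if "\<alpha> \<in> ?A" for \<alpha>
  proof -
    let ?S = "(\<lambda>\<mu>. \<mu> - \<alpha>) ` ?B"
    have "{\<beta>. g \<beta> \<noteq> 0 \<and> h (\<gamma> - \<alpha> - \<beta>) \<noteq> 0} \<subseteq> ?S"
    proof
      fix \<beta> assume "\<beta> \<in> {\<beta>. g \<beta> \<noteq> 0 \<and> h (\<gamma> - \<alpha> - \<beta>) \<noteq> 0}"
      then have "\<beta> + \<alpha> \<in> ?B"
        using that bounded_by_box[OF g h, of "\<gamma> - \<alpha>"] by (force simp: in_box)
      then show "\<beta> \<in> ?S" by (rule rev_image_eqI) simp
    qed
    then have "qmult g h (\<gamma> - \<alpha>) = (\<Sum>\<beta>\<in>?S. nu_pow (Lam \<beta> (\<gamma> - \<alpha> - \<beta>)) * g \<beta> * h (\<gamma> - \<alpha> - \<beta>))"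
      by (intro qmult_eq) simp_all
    also have "\<dots> = (\<Sum>\<mu>\<in>?B. nu_pow (Lam (\<mu> - \<alpha>) (\<gamma> - \<mu>)) * g (\<mu> - \<alpha>) * h (\<gamma> - \<mu>))"
      by (subst sum.reindex) (auto simp: inj_on_def)
    finally show ?thesis .
  qed
  have pw: "nu_pow (Lam \<mu> (\<gamma> - \<mu>)) * (nu_pow (Lam \<alpha> (\<mu> - \<alpha>)) * a * b) * c
      = nu_pow (Lam \<alpha> (\<gamma> - \<alpha>)) * a * (nu_pow (Lam (\<mu> - \<alpha>) (\<gamma> - \<mu>)) * b * c)"
    for \<alpha> \<mu> and a b c
  proof -
    have "Lam \<mu> (\<gamma> - \<mu>) + Lam \<alpha> (\<mu> - \<alpha>) = Lam \<alpha> (\<gamma> - \<alpha>) + Lam (\<mu> - \<alpha>) (\<gamma> - \<mu>)"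
      by (simp add: Lam_def algebra_simps)
    then have "nu_pow (Lam \<mu> (\<gamma> - \<mu>)) * nu_pow (Lam \<alpha> (\<mu> - \<alpha>))
        = nu_pow (Lam \<alpha> (\<gamma> - \<alpha>)) * nu_pow (Lam (\<mu> - \<alpha>) (\<gamma> - \<mu>))"
      by (metis nu_pow_add)
    then show ?thesis by (metis (no_types, lifting) mult.assoc mult.commute)
  qed
  have "qmult (qmult f g) h \<gamma>
      = (\<Sum>\<mu>\<in>?B. nu_pow (Lam \<mu> (\<gamma> - \<mu>)) * qmult f g \<mu> * h (\<gamma> - \<mu>))"
    by (rule qmult_eq_box[OF fg h])
  also have "\<dots> = (\<Sum>\<mu>\<in>?B. \<Sum>\<alpha>\<in>?A.
      nu_pow (Lam \<mu> (\<gamma> - \<mu>)) * (nu_pow (Lam \<alpha> (\<mu> - \<alpha>)) * f \<alpha> * g (\<mu> - \<alpha>)) * h (\<gamma> - \<mu>))"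
    by (intro sum.cong refl) (simp add: inner1 sum_distrib_left sum_distrib_right)
  also have "\<dots> = (\<Sum>\<alpha>\<in>?A. \<Sum>\<mu>\<in>?B.
      nu_pow (Lam \<alpha> (\<gamma> - \<alpha>)) * f \<alpha> * (nu_pow (Lam (\<mu> - \<alpha>) (\<gamma> - \<mu>)) * g (\<mu> - \<alpha>) * h (\<gamma> - \<mu>)))"
    by (subst sum.swap) (simp only: pw)
  also have "\<dots> = (\<Sum>\<alpha>\<in>?A. nu_pow (Lam \<alpha> (\<gamma> - \<alpha>)) * f \<alpha> * qmult g h (\<gamma> - \<alpha>))"
    by (intro sum.cong refl) (simp add: inner2 sum_distrib_left)
  also have "\<dots> = qmult f (qmult g h) \<gamma>"
    using qmult_eq_box[OF f gh, of \<gamma>] by (simp add: algebra_simps)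
  finally show ?thesis .
qed

instantiation qtorus :: ring_1
begin

lift_definition zero_qtorus :: qtorus is "\<lambda>_. 0"
  by simp

lift_definition one_qtorus :: qtorus is "\<lambda>\<alpha>. if \<alpha> = 0 then 1 else 0"
  by (auto simp: zero_prod_def)

lift_definition plus_qtorus :: "qtorus \<Rightarrow> qtorus \<Rightarrow> qtorus" is "\<lambda>f g \<alpha>. f \<alpha> + g \<alpha>"
proof -
  fix f g :: "expo \<Rightarrow> laurent"
  assume "\<exists>a b. \<forall>\<alpha>. f \<alpha> \<noteq> 0 \<longrightarrow> fst \<alpha> \<le> a \<and> snd \<alpha> \<le> b"
    and "\<exists>a b. \<forall>\<alpha>. g \<alpha> \<noteq> 0 \<longrightarrow> fst \<alpha> \<le> a \<and> snd \<alpha> \<le> b"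
  then obtain a b c d where
    "\<And>\<alpha>. f \<alpha> \<noteq> 0 \<Longrightarrow> fst \<alpha> \<le> a \<and> snd \<alpha> \<le> b" "\<And>\<alpha>. g \<alpha> \<noteq> 0 \<Longrightarrow> fst \<alpha> \<le> c \<and> snd \<alpha> \<le> d"
    by metis
  then have "\<forall>\<alpha>. f \<alpha> + g \<alpha> \<noteq> 0 \<longrightarrow> fst \<alpha> \<le> max a c \<and> snd \<alpha> \<le> max b d"
    by (metis add.right_neutral add.left_neutral le_max_iff_disj)
  then show "\<exists>a b. \<forall>\<alpha>. f \<alpha> + g \<alpha> \<noteq> 0 \<longrightarrow> fst \<alpha> \<le> a \<and> snd \<alpha> \<le> b"
    by blast
qed

lift_definition uminus_qtorus :: "qtorus \<Rightarrow> qtorus" is "\<lambda>f \<alpha>. - f \<alpha>"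
  by simp

definition minus_qtorus :: "qtorus \<Rightarrow> qtorus \<Rightarrow> qtorus"
  where "minus_qtorus f g = f + - g"

lift_definition times_qtorus :: "qtorus \<Rightarrow> qtorus \<Rightarrow> qtorus" is qmult
proof -
  fix f g :: "expo \<Rightarrow> laurent"
  assume "\<exists>a b. \<forall>\<alpha>. f \<alpha> \<noteq> 0 \<longrightarrow> fst \<alpha> \<le> a \<and> snd \<alpha> \<le> b"
    and "\<exists>a b. \<forall>\<alpha>. g \<alpha> \<noteq> 0 \<longrightarrow> fst \<alpha> \<le> a \<and> snd \<alpha> \<le> b"
  then obtain M N where "bounded_by M f" "bounded_by N g"
    by (auto simp: bounded_by_def)
  then have "bounded_by (M + N) (qmult f g)"
    by (rule bounded_by_qmult)
  then show "\<exists>a b. \<forall>\<alpha>. qmult f g \<alpha> \<noteq> 0 \<longrightarrow> fst \<alpha> \<le> a \<and> snd \<alpha> \<le> b"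
    unfolding bounded_by_def by blast
qed

instance
proof
  fix f g h :: qtorus
  show "f + g + h = f + (g + h)" "f + g = g + f" "0 + f = f" "- f + f = 0"
    by (transfer; simp add: fun_eq_iff algebra_simps)+
  show "f - g = f + - g"
    by (simp add: minus_qtorus_def)
  obtain K M N where K: "bounded_by K (coeff f)" and M: "bounded_by M (coeff g)"
    and N: "bounded_by N (coeff h)"
    using bounded_by_coeff by metis
  show "f * g * h = f * (g * h)"
    by (rule qtorus_eqI) (simp add: times_qtorus.rep_eq qmult_assoc[OF K M N])
  show "1 * f = f"
  proof (rule qtorus_eqI)
    fix \<gamma>
    have "coeff (1 * f) \<gamma> = (\<Sum>\<alpha>\<in>{0}. nu_pow (Lam \<alpha> (\<gamma> - \<alpha>)) * coeff 1 \<alpha> * coeff f (\<gamma> - \<alpha>))"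
      unfolding times_qtorus.rep_eq
      by (intro qmult_eq) (auto simp: one_qtorus.rep_eq split: if_splits)
    then show "coeff (1 * f) \<gamma> = coeff f \<gamma>"
      by (simp add: one_qtorus.rep_eq)
  qed
  show "f * 1 = f"
  proof (rule qtorus_eqI)
    fix \<gamma>
    have "coeff (f * 1) \<gamma> = (\<Sum>\<alpha>\<in>{\<gamma>}. nu_pow (Lam \<alpha> (\<gamma> - \<alpha>)) * coeff f \<alpha> * coeff 1 (\<gamma> - \<alpha>))"
      unfolding times_qtorus.rep_eq
      by (intro qmult_eq) (auto simp: one_qtorus.rep_eq split: if_splits)
    then show "coeff (f * 1) \<gamma> = coeff f \<gamma>"
      by (simp add: one_qtorus.rep_eq)
  qed
  show "(f + g) * h = f * h + g * h"
  proof (rule qtorus_eqI)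
    fix \<gamma>
    let ?S = "box (\<gamma> - N) K \<union> box (\<gamma> - N) M"
    have S: "{\<alpha>. coeff k \<alpha> \<noteq> 0 \<and> coeff h (\<gamma> - \<alpha>) \<noteq> 0} \<subseteq> ?S" if "k \<in> {f, g, f + g}" for k
    proof
      fix \<alpha> assume \<alpha>: "\<alpha> \<in> {\<alpha>. coeff k \<alpha> \<noteq> 0 \<and> coeff h (\<gamma> - \<alpha>) \<noteq> 0}"
      then have "coeff f \<alpha> \<noteq> 0 \<or> coeff g \<alpha> \<noteq> 0"
        using that by (auto simp: plus_qtorus.rep_eq)
      with \<alpha> show "\<alpha> \<in> ?S"
        using bounded_by_box[OF K N, of \<gamma>] bounded_by_box[OF M N, of \<gamma>] by blast
    qed
    have E: "coeff (k * h) \<gamma> = (\<Sum>\<alpha>\<in>?S. nu_pow (Lam \<alpha> (\<gamma> - \<alpha>)) * coeff k \<alpha> * coeff h (\<gamma> - \<alpha>))"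
      if "k \<in> {f, g, f + g}" for k
      unfolding times_qtorus.rep_eq using S[OF that] by (intro qmult_eq) auto
    show "coeff ((f + g) * h) \<gamma> = coeff (f * h + g * h) \<gamma>"
      by (simp add: E plus_qtorus.rep_eq[of "f * h"])
         (simp add: plus_qtorus.rep_eq distrib_left distrib_right sum.distrib)
  qed
  show "h * (f + g) = h * f + h * g"
  proof (rule qtorus_eqI)
    fix \<gamma>
    let ?S = "box (\<gamma> - K) N \<union> box (\<gamma> - M) N"
    have S: "{\<alpha>. coeff h \<alpha> \<noteq> 0 \<and> coeff k (\<gamma> - \<alpha>) \<noteq> 0} \<subseteq> ?S" if "k \<in> {f, g, f + g}" for k
    proof
      fix \<alpha> assume \<alpha>: "\<alpha> \<in> {\<alpha>. coeff h \<alpha> \<noteq> 0 \<and> coeff k (\<gamma> - \<alpha>) \<noteq> 0}"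
      then have "coeff f (\<gamma> - \<alpha>) \<noteq> 0 \<or> coeff g (\<gamma> - \<alpha>) \<noteq> 0"
        using that by (auto simp: plus_qtorus.rep_eq)
      with \<alpha> show "\<alpha> \<in> ?S"
        using bounded_by_box[OF N K, of \<gamma>] bounded_by_box[OF N M, of \<gamma>] by blast
    qed
    have E: "coeff (h * k) \<gamma> = (\<Sum>\<alpha>\<in>?S. nu_pow (Lam \<alpha> (\<gamma> - \<alpha>)) * coeff h \<alpha> * coeff k (\<gamma> - \<alpha>))"
      if "k \<in> {f, g, f + g}" for k
      unfolding times_qtorus.rep_eq using S[OF that] by (intro qmult_eq) auto
    show "coeff (h * (f + g)) \<gamma> = coeff (h * f + h * g) \<gamma>"
      by (simp add: E plus_qtorus.rep_eq[of "h * f"])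
         (simp add: plus_qtorus.rep_eq distrib_left sum.distrib)
  qed
  show "(0 :: qtorus) \<noteq> 1"
    by transfer (metis one_neq_zero)
qed

end

lift_definition qscale :: "laurent \<Rightarrow> qtorus \<Rightarrow> qtorus" (infixr "*\<^sub>\<nu>" 75)
  is "\<lambda>c f \<alpha>. c * f \<alpha>"
  by (metis mult_zero_right)

global_interpretation qtorus: module qscale
  by standard (transfer; simp add: fun_eq_iff algebra_simps)+

lemma qscale_mult_left: "(c *\<^sub>\<nu> f) * g = c *\<^sub>\<nu> (f * g)"
  and qscale_mult_right: "f * (c *\<^sub>\<nu> g) = c *\<^sub>\<nu> (f * g)"
proof -
  obtain M N where M: "bounded_by M (coeff f)" and N: "bounded_by N (coeff g)"
    using bounded_by_coeff by metis
  have M': "bounded_by M (\<lambda>\<alpha>. c * coeff f \<alpha>)"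
    and N': "bounded_by N (\<lambda>\<alpha>. c * coeff g \<alpha>)"
    using M N by (auto simp: bounded_by_def)
  show "(c *\<^sub>\<nu> f) * g = c *\<^sub>\<nu> (f * g)"
    by (rule qtorus_eqI)
       (simp add: times_qtorus.rep_eq qscale.rep_eq qmult_eq_box[OF M' N] qmult_eq_box[OF M N]
          sum_distrib_left mult_ac)
  show "f * (c *\<^sub>\<nu> g) = c *\<^sub>\<nu> (f * g)"
    by (rule qtorus_eqI)
       (simp add: times_qtorus.rep_eq qscale.rep_eq qmult_eq_box[OF M N'] qmult_eq_box[OF M N]
          sum_distrib_left mult_ac)
qed

lift_definition X :: "expo \<Rightarrow> qtorus" is "\<lambda>\<alpha> \<beta>. if \<beta> = \<alpha> then 1 else 0"
  by (metis order_refl)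

lemma X_0: "X 0 = 1"
  by transfer simp

lemma X_mult: "X \<alpha> * X \<beta> = nu_pow (Lam \<alpha> \<beta>) *\<^sub>\<nu> X (\<alpha> + \<beta>)"
proof (rule qtorus_eqI)
  fix \<gamma>
  have "coeff (X \<alpha> * X \<beta>) \<gamma>
      = (\<Sum>\<mu>\<in>{\<alpha>}. nu_pow (Lam \<mu> (\<gamma> - \<mu>)) * coeff (X \<alpha>) \<mu> * coeff (X \<beta>) (\<gamma> - \<mu>))"
    unfolding times_qtorus.rep_eq by (intro qmult_eq) (auto simp: X.rep_eq split: if_splits)
  then show "coeff (X \<alpha> * X \<beta>) \<gamma> = coeff (nu_pow (Lam \<alpha> \<beta>) *\<^sub>\<nu> X (\<alpha> + \<beta>)) \<gamma>"
    by (auto simp: X.rep_eq qscale.rep_eq algebra_simps)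
qed

text \<open>The formal sum of the terms \<open>c\<^sub>r X\<^bsup>e\<^sub>r\<^esup>\<close> over all \<open>r \<in> I\<close>. It is only meaningful if every
  exponent occurs finitely often and the exponents are bounded above in both coordinates.\<close>

definition formal_sum :: "'i set \<Rightarrow> ('i \<Rightarrow> laurent) \<Rightarrow> ('i \<Rightarrow> expo) \<Rightarrow> qtorus"
  where "formal_sum I c e = Abs_qtorus (\<lambda>\<alpha>. \<Sum>r | r \<in> I \<and> e r = \<alpha>. c r)"

lemma coeff_formal_sum:
  assumes "\<And>r. r \<in> I \<Longrightarrow> fst (e r) \<le> a \<and> snd (e r) \<le> b"
  shows "coeff (formal_sum I c e) \<alpha> = (\<Sum>r | r \<in> I \<and> e r = \<alpha>. c r)"
proof -
  have "fst \<beta> \<le> a \<and> snd \<beta> \<le> b" if "(\<Sum>r | r \<in> I \<and> e r = \<beta>. c r) \<noteq> 0" for \<beta>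
  proof -
    have "{r. r \<in> I \<and> e r = \<beta>} \<noteq> {}" using that by (metis sum.empty)
    then show ?thesis using assms by blast
  qed
  then show ?thesis
    unfolding formal_sum_def by (subst Abs_qtorus_inverse) blast+
qed


section \<open>The bar-involution\<close>

text \<open>Applied coefficientwise to formal sums, which is the reading under which its values on
  \<open>\<nu>\<close> and on the \<open>X\<^sup>\<alpha>\<close> determine it; the lemmas below show that it is an additive involutive
  anti-automorphism with the prescribed values.\<close>

lift_definition bar :: "qtorus \<Rightarrow> qtorus" is "\<lambda>f \<alpha>. laurent_bar (f \<alpha>)"
  by simp

lemma bar_add: "bar (f + g) = bar f + bar g"
  by transfer simp

lemma bar_bar: "bar (bar f) = f"
  by transfer simp

lemma bar_X: "bar (X \<alpha>) = X \<alpha>"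
  by transfer auto

lemma bar_qscale: "bar (c *\<^sub>\<nu> f) = laurent_bar c *\<^sub>\<nu> bar f"
  by transfer simp

lemma bar_one: "bar 1 = 1"
  by transfer auto

lemma bar_mult: "bar (f * g) = bar g * bar f"
proof (rule qtorus_eqI)
  fix \<gamma>
  have "- Lam \<alpha> \<beta> = Lam \<beta> \<alpha>" for \<alpha> \<beta>
    by (simp add: Lam_def)
  then have "coeff (bar (f * g)) \<gamma>
      = (\<Sum>(\<alpha>, \<beta>) | \<alpha> + \<beta> = \<gamma> \<and> coeff f \<alpha> \<noteq> 0 \<and> coeff g \<beta> \<noteq> 0.
          nu_pow (Lam \<beta> \<alpha>) * laurent_bar (coeff f \<alpha>) * laurent_bar (coeff g \<beta>))"
    by (simp add: bar.rep_eq times_qtorus.rep_eq qmult_def laurent_bar_sum case_prod_unfold)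
  also have "\<dots> = (\<Sum>(\<beta>, \<alpha>) | \<beta> + \<alpha> = \<gamma> \<and> coeff (bar g) \<beta> \<noteq> 0 \<and> coeff (bar f) \<alpha> \<noteq> 0.
          nu_pow (Lam \<beta> \<alpha>) * coeff (bar g) \<beta> * coeff (bar f) \<alpha>)"
    by (rule sum.reindex_bij_witness[of _ prod.swap prod.swap])
       (auto simp: bar.rep_eq add.commute mult_ac)
  also have "\<dots> = coeff (bar g * bar f) \<gamma>"
    by (simp add: times_qtorus.rep_eq qmult_def)
  finally show "coeff (bar (f * g)) \<gamma> = coeff (bar g * bar f) \<gamma>" .
qed


section \<open>The quantum cluster algebra\<close>

definition XO :: "int \<Rightarrow> qtorus"
  where "XO l = X (- (l + 1, - 1))
    + formal_sum {- l..} (\<lambda>r. nu_pow (- 2 * (l + r)) * qint (l + r + 1)) (\<lambda>r. - (l + 2 * r + 1, 1))"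

lemma coeff_XO: "coeff (XO l) \<alpha> = coeff (X (- (l + 1, - 1))) \<alpha>
    + (\<Sum>r | r \<in> {- l..} \<and> - (l + 2 * r + 1, 1) = \<alpha>. nu_pow (- 2 * (l + r)) * qint (l + r + 1))"
  unfolding XO_def plus_qtorus.rep_eq
  by (subst coeff_formal_sum[where a = "l - 1" and b = "- 1"]) auto

lemma coeff_XO_top: "coeff (XO l) (- l - 1, 1) = 1"
  by (simp add: coeff_XO X.rep_eq)

lemma coeff_XO_term:
  assumes "r \<ge> - l"
  shows "coeff (XO l) (- l - 2 * r - 1, - 1) = nu_pow (- 2 * (l + r)) * qint (l + r + 1)"
proof -
  have "{s. s \<in> {- l..} \<and> - (l + 2 * s + 1, 1 :: int) = (- l - 2 * r - 1, - 1)} = {r}"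
    using assms by auto
  then show ?thesis by (simp only: coeff_XO) (simp add: X.rep_eq)
qed

definition subalgebra :: "qtorus set \<Rightarrow> bool"
  where "subalgebra S \<longleftrightarrow> qtorus.subspace S \<and> 1 \<in> S \<and> (\<forall>f\<in>S. \<forall>g\<in>S. f * g \<in> S)"

text \<open>The exchange matrix does not enter: the algebra is given by its generators.\<close>

definition cluster_algebra :: "qtorus set"
  where "cluster_algebra = subalgebra hull (range XO)"

lemma subalgebra_cluster_algebra: "subalgebra cluster_algebra"
  unfolding cluster_algebra_def
  by (rule hull_in) (auto simp: subalgebra_def qtorus.subspace_Inter)

definition is_basis :: "qtorus set \<Rightarrow> qtorus set \<Rightarrow> bool"
  where "is_basis S M \<longleftrightarrow> qtorus.independent S \<and> qtorus.span S = M"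


section \<open>The three candidate bases\<close>

definition X_ndelta :: "nat \<Rightarrow> qtorus"
  where "X_ndelta n = (if n = 0 then 1 else X (- (int n, 0)) + X (int n, 0))"

definition X_E :: "nat \<Rightarrow> qtorus"
  where "X_E n = (\<Sum>l = 0..n. X (- (int n - 2 * int l, 0)))"

definition B1_tor :: "qtorus set"
  where "B1_tor = {X_ndelta r | r. True}"

definition B2_tor :: "qtorus set"
  where "B2_tor = {X_ndelta 1 ^ r | r. True}"

definition B3_tor :: "qtorus set"
  where "B3_tor = {X_E r | r. True}"

definition B_vet :: "qtorus set"
  where "B_vet = (\<Union>r\<in>{1 :: nat..}.
    {nu_pow (int (d * (r - d))) *\<^sub>\<nu> (XO l ^ d * XO (l + 1) ^ (r - d)) | l d. 1 \<le> d \<and> d \<le> r})"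

end

theory Submission
  imports Defs "HOL-Library.Product_Lexorder"
begin

text \<open>With \<open>\<delta> = X\<^bsup>(-1,0)\<^esup> + X\<^bsup>(1,0)\<^esup>\<close>, a comparison of coefficients gives
  \<open>\<delta> X\<^sub>l = \<nu>\<^bsup>-1\<^esup> X\<^sub>l\<^sub>-\<^sub>1 + \<nu> X\<^sub>l\<^sub>+\<^sub>1\<close>, the quasi-commutation
  \<open>X\<^sub>l\<^sub>+\<^sub>1 X\<^sub>l = \<nu>\<^sup>2 X\<^sub>l X\<^sub>l\<^sub>+\<^sub>1\<close> and the exchange relation
  \<open>X\<^sub>l\<^sub>-\<^sub>1 X\<^sub>l\<^sub>+\<^sub>1 = \<nu>\<^bsup>-2\<^esup> X\<^sub>l\<^sup>2 + 1\<close>, where \<open>X\<^sub>l\<close> is \<open>XO l\<close>. The span of a candidate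
  basis is stable under left multiplication by \<open>\<delta>\<close>. As \<open>X\<^sub>l\<close> and \<open>X\<^sub>l\<^sub>+\<^sub>1\<close> map a cluster monomial in
  \<open>X\<^sub>l, X\<^sub>l\<^sub>+\<^sub>1\<close> to a multiple of a cluster monomial, the first relation shows that the span is stable
  under all generators, hence contains the algebra. Conversely, \<open>X\<^sub>0 X\<^sub>3\<close> shows that \<open>\<delta>\<close> lies in the
  algebra. Independence holds because the candidates have pairwise distinct lexicographically leading
  exponents.\<close>

section \<open>Coefficient extraction and bar-invariant quantum integers\<close>

lemma nu_pow_mult: "nu_pow j * nu_pow k = nu_pow (j + k)"
  by (simp add: nu_pow_add)

lemma coeff_0 [simp]: "coeff 0 \<gamma> = 0"
  by (simp add: zero_qtorus.rep_eq)

lemma coeff_add [simp]: "coeff (f + g) \<gamma> = coeff f \<gamma> + coeff g \<gamma>"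
  by (simp add: plus_qtorus.rep_eq)

lemma coeff_uminus [simp]: "coeff (- f) \<gamma> = - coeff f \<gamma>"
  by (simp add: uminus_qtorus.rep_eq)

lemma coeff_diff [simp]: "coeff (f - g) \<gamma> = coeff f \<gamma> - coeff g \<gamma>"
  by (simp only: diff_conv_add_uminus coeff_add coeff_uminus)

lemma coeff_qscale [simp]: "coeff (c *\<^sub>\<nu> f) \<gamma> = c * coeff f \<gamma>"
  by (simp add: qscale.rep_eq)

lemma coeff_sum: "coeff (sum f A) \<gamma> = (\<Sum>a\<in>A. coeff (f a) \<gamma>)"
  by (induction A rule: infinite_finite_induct) auto

lemma coeff_X_mult: "coeff (X \<alpha> * f) \<gamma> = nu_pow (Lam \<alpha> \<gamma>) * coeff f (\<gamma> - \<alpha>)"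
proof -
  have "coeff (X \<alpha> * f) \<gamma>
      = (\<Sum>\<mu>\<in>{\<alpha>}. nu_pow (Lam \<mu> (\<gamma> - \<mu>)) * coeff (X \<alpha>) \<mu> * coeff f (\<gamma> - \<mu>))"
    unfolding times_qtorus.rep_eq by (intro qmult_eq) (auto simp: X.rep_eq split: if_splits)
  then show ?thesis by (simp add: X.rep_eq Lam_def algebra_simps)
qed

lemma coeff_mult_X: "coeff (f * X \<alpha>) \<gamma> = nu_pow (Lam \<gamma> \<alpha>) * coeff f (\<gamma> - \<alpha>)"
proof -
  have "coeff (f * X \<alpha>) \<gamma>
      = (\<Sum>\<mu>\<in>{\<gamma> - \<alpha>}. nu_pow (Lam \<mu> (\<gamma> - \<mu>)) * coeff f \<mu> * coeff (X \<alpha>) (\<gamma> - \<mu>))"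
    unfolding times_qtorus.rep_eq by (intro qmult_eq) (auto simp: X.rep_eq split: if_splits)
  then show ?thesis by (simp add: X.rep_eq Lam_def algebra_simps)
qed

text \<open>\<open>sqint s\<close> is the bar-invariant quantum integer \<open>[s + 1]\<close> in the variable \<open>\<nu>\<^sup>2\<close>, extended by zero
  to negative \<open>s\<close> so that coefficient identities need no case distinctions.\<close>

definition sqint :: "int \<Rightarrow> laurent"
  where "sqint s = (if s \<ge> 0 then nu_pow (- 2 * s) * qint (s + 1) else 0)"

lemma sqint_neg [simp]: "s < 0 \<Longrightarrow> sqint s = 0"
  by (simp add: sqint_def)

lemma qint_0 [simp]: "qint 0 = 0"
  by (rule qint_eqI) simp

text \<open>The closed form of a quantum integer with its denominator cleared. Admitting
  \<open>s = - 1\<close>, where both sides vanish, makes it usable for shifted indices.\<close>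

lemma sqint_times:
  assumes "s \<ge> - 1"
  shows "sqint s * (nu_pow 2 - nu_pow (- 2)) = nu_pow (2 * s + 2) - nu_pow (- 2 * s - 2)"
proof -
  have "sqint s = nu_pow (- 2 * s) * qint (s + 1)"
    using assms by (cases "s = - 1") (auto simp: sqint_def)
  moreover have "nu_pow 2 - nu_pow (- 2) = (nu_pow 4 - 1) * nu_pow (- 2)"
    by (simp add: algebra_simps nu_pow_mult)
  ultimately have "sqint s * (nu_pow 2 - nu_pow (- 2))
      = (nu_pow (- 2 * s) * nu_pow (- 2)) * (qint (s + 1) * (nu_pow 4 - 1))"
    by (simp only: mult_ac)
  also have "\<dots> = (nu_pow (- 2 * s) * nu_pow (- 2)) * (nu_pow (4 * (s + 1)) - 1)"
    using assms by (subst qint_quotient) auto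
  also have "\<dots> = nu_pow (2 * s + 2) - nu_pow (- 2 * s - 2)"
    by (simp add: algebra_simps nu_pow_mult)
  finally show ?thesis .
qed

lemma nu_pow_diff_nonzero: "nu_pow 2 - nu_pow (- 2) \<noteq> 0"
  using nu_pow_eq_iff[of 2 "- 2"] by (simp del: nu_pow_eq_iff)

lemma laurent_bar_diff: "laurent_bar (p - q) = laurent_bar p - laurent_bar q"
  by (metis add_diff_cancel_right' diff_add_cancel laurent_bar_add)

text \<open>Numerator and denominator of the closed form both change sign under the
  bar-involution.\<close>

lemma laurent_bar_sqint [simp]: "laurent_bar (sqint s) = sqint s"
proof (cases "s < 0")
  case False
  define d where "d = nu_pow 2 - nu_pow (- 2)"
  define e where "e = nu_pow (2 * s + 2) - nu_pow (- 2 * s - 2)"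
  have "sqint s * d = e"
    using False sqint_times[of s] by (simp add: d_def e_def)
  moreover have "laurent_bar d = - d" "laurent_bar e = - e"
    by (simp_all add: d_def e_def laurent_bar_diff)
  ultimately have "laurent_bar (sqint s) * d = sqint s * d"
    by (metis laurent_bar_mult mult_minus_right neg_equal_iff_equal)
  then show ?thesis
    using nu_pow_diff_nonzero[folded d_def] by simp
qed simp

lemma sqint_0 [simp]: "sqint 0 = 1"
  using qint_of_nat[of 1] by (simp add: sqint_def)

text \<open>Compares the coefficients of X^(-1-2t, 0) in the quasi-commutation relation. Multiplied
  by \<nu>^2 - \<nu>^-2, it becomes an identity between powers of \<nu>.\<close>

lemma sqint_commutation:
  "nu_pow (- 1 - 2 * t) * sqint (t - 1) + nu_pow (1 + 2 * t) * sqint t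
    = nu_pow 2 * (nu_pow (- 1 - 2 * t) * sqint t + nu_pow (1 + 2 * t) * sqint (t - 1))"
proof (cases "t < 0")
  case False
  define d where "d = nu_pow 2 - nu_pow (- 2)"
  have times: "sqint s * d = nu_pow (2 * s + 2) - nu_pow (- 2 * s - 2)" if "s \<ge> - 1" for s
    using sqint_times[OF that] by (simp add: d_def)
  have "(nu_pow (- 1 - 2 * t) * sqint (t - 1) + nu_pow (1 + 2 * t) * sqint t) * d
    = nu_pow (- 1 - 2 * t) * (sqint (t - 1) * d) + nu_pow (1 + 2 * t) * (sqint t * d)"
    by (simp add: algebra_simps)
  also have "\<dots> = nu_pow 2 * (nu_pow (- 1 - 2 * t) * (sqint t * d) + nu_pow (1 + 2 * t) * (sqint (t - 1) * d))"
    using False by (simp add: times distrib_left right_diff_distrib nu_pow_mult; simp add: algebra_simps)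
  also have "\<dots> = nu_pow 2 * (nu_pow (- 1 - 2 * t) * sqint t + nu_pow (1 + 2 * t) * sqint (t - 1)) * d"
    by (simp add: algebra_simps)
  finally show ?thesis
    using nu_pow_diff_nonzero[folded d_def] by simp
qed simp

text \<open>Compares the coefficients of X^(-2t, 0) in the exchange relation.\<close>

lemma sqint_exchange:
  "nu_pow (- 2 * t) * sqint t + nu_pow (2 * t) * sqint (t - 2)
    = nu_pow (- 2) * (nu_pow (- 2 * t) * sqint (t - 1) + nu_pow (2 * t) * sqint (t - 1))
      + (if t = 0 then 1 else 0)"
proof (cases "t < 1")
  \<comment> \<open>At \<open>t = 0\<close> the index \<open>t - 2\<close> is below the range of the
    closed form; the extended values of \<open>sqint\<close> give the constant 1 directly.\<close>
  case True
  then show ?thesis by (cases "t = 0") auto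
next
  case False
  define d where "d = nu_pow 2 - nu_pow (- 2)"
  have times: "sqint s * d = nu_pow (2 * s + 2) - nu_pow (- 2 * s - 2)" if "s \<ge> - 1" for s
    using sqint_times[OF that] by (simp add: d_def)
  have "(nu_pow (- 2 * t) * sqint t + nu_pow (2 * t) * sqint (t - 2)) * d
    = nu_pow (- 2 * t) * (sqint t * d) + nu_pow (2 * t) * (sqint (t - 2) * d)"
    by (simp add: algebra_simps)
  also have "\<dots> = nu_pow (- 2) * (nu_pow (- 2 * t) * (sqint (t - 1) * d) + nu_pow (2 * t) * (sqint (t - 1) * d))"
    using False by (simp add: times distrib_left right_diff_distrib nu_pow_mult; simp add: algebra_simps)
  also have "\<dots> = nu_pow (- 2) * (nu_pow (- 2 * t) * sqint (t - 1) + nu_pow (2 * t) * sqint (t - 1)) * d"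
    by (simp add: algebra_simps)
  finally show ?thesis
    using nu_pow_diff_nonzero[folded d_def] False by simp
qed

section \<open>Splitting a generator into its top monomial and its infinite tail\<close>

definition XO_low :: "int \<Rightarrow> qtorus"
  where "XO_low l = XO l - X (- l - 1, 1)"

lemma XO_split: "XO l = X (- l - 1, 1) + XO_low l"
  by (simp add: XO_low_def)

text \<open>The substitution \<open>s = l + r\<close> turns the coefficient into a function of
  \<open>l - 1 - fst \<alpha>\<close> alone.\<close>

lemma coeff_XO_low:
  "coeff (XO_low l) \<alpha>
    = (if snd \<alpha> = - 1 \<and> even (l - 1 - fst \<alpha>) then sqint ((l - 1 - fst \<alpha>) div 2) else 0)"
proof -
  obtain a b where \<alpha>: "\<alpha> = (a, b)" by (cases \<alpha>)
  let ?I = "{r. r \<in> {- l..} \<and> - (l + 2 * r + 1, 1) = \<alpha>}"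
  let ?c = "\<lambda>r. nu_pow (- 2 * (l + r)) * qint (l + r + 1)"
  have low: "coeff (XO_low l) \<alpha> = (\<Sum>r\<in>?I. ?c r)"
    by (simp add: XO_low_def coeff_XO X.rep_eq)
  show ?thesis
  proof (cases "b = - 1 \<and> even (l - 1 - a) \<and> a \<le> l - 1")
    case True
    then obtain s where s: "l - 1 - a = 2 * s" by (metis dvdE)
    then have "?I = {s - l}" using True \<alpha> by auto
    then have "coeff (XO_low l) \<alpha> = ?c (s - l)" unfolding low by simp
    then show ?thesis
      using True s \<alpha> by (simp add: sqint_def)
  next
    case False
    then have "?I = {}" using \<alpha> by auto
    then have "coeff (XO_low l) \<alpha> = 0" unfolding low by (simp only: sum.empty)
    moreover have "sqint ((l - 1 - a) div 2) = 0" if "\<not> a \<le> l - 1"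
      using that by (intro sqint_neg) auto
    ultimately show ?thesis using False \<alpha> by auto
  qed
qed

lemma bar_XO [simp]: "bar (XO l) = XO l"
proof -
  have "bar (XO_low l) = XO_low l"
    by (rule qtorus_eqI) (simp add: bar.rep_eq coeff_XO_low)
  then show ?thesis
    by (simp add: XO_split bar_add bar_X)
qed

section \<open>Relations\<close>

definition \<delta> :: qtorus
  where "\<delta> = X (- 1, 0) + X (1, 0)"

lemma bar_power: "bar (f ^ n) = bar f ^ n"
  by (induction n) (simp_all add: bar_one bar_mult power_commutes)

lemma bar_delta [simp]: "bar \<delta> = \<delta>"
  by (simp add: \<delta>_def bar_add bar_X)

text \<open>Tails of consecutive generators are translates by (1, 0). All tail exponents have second
  coordinate -1, so \<open>X (1, 0)\<close> contributes the uniform twist \<nu> on the left and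
  \<nu>^-1 on the right.\<close>

lemma XO_low_Suc: "XO_low (l + 1) = nu_pow (- 1) *\<^sub>\<nu> (X (1, 0) * XO_low l)"
  and XO_low_Suc': "XO_low (l + 1) = nu_pow 1 *\<^sub>\<nu> (XO_low l * X (1, 0))"
  by (rule qtorus_eqI;
      auto simp: coeff_X_mult coeff_mult_X coeff_XO_low Lam_def nu_pow_mult algebra_simps
        simp flip: mult.assoc)+

text \<open>Moving the translating monomial \<open>X (1, 0)\<close> between the tails avoids
  expanding a product of two infinite sums.\<close>

lemma XO_low_commute: "XO_low (l + 1) * XO_low l = nu_pow 2 *\<^sub>\<nu> (XO_low l * XO_low (l + 1))"
proof -
  have "XO_low l * XO_low (l + 1) = nu_pow (- 1) *\<^sub>\<nu> ((XO_low l * X (1, 0)) * XO_low l)"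
    by (simp add: XO_low_Suc qscale_mult_right mult.assoc)
  also have "XO_low l * X (1, 0) = nu_pow (- 1) *\<^sub>\<nu> XO_low (l + 1)"
    by (simp add: XO_low_Suc' nu_pow_mult)
  finally show ?thesis
    by (simp add: qscale_mult_left nu_pow_mult)
qed

lemma XO_low_exchange:
  "XO_low (l - 1) * XO_low (l + 1) = nu_pow (- 2) *\<^sub>\<nu> (XO_low l * XO_low l)"
proof -
  have "XO_low (l - 1) * XO_low (l + 1) = nu_pow (- 1) *\<^sub>\<nu> ((XO_low (l - 1) * X (1, 0)) * XO_low l)"
    by (simp add: XO_low_Suc qscale_mult_right mult.assoc)
  also have "XO_low (l - 1) * X (1, 0) = nu_pow (- 1) *\<^sub>\<nu> XO_low l"
    using XO_low_Suc'[of "l - 1"] by (simp add: nu_pow_mult)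
  finally show ?thesis
    by (simp add: qscale_mult_left nu_pow_mult)
qed

text \<open>Both products split by second coordinate 2, 0, -2 into monomials, mixed terms and tails;
  coefficients are compared only in the mixed part.\<close>

lemma XO_commute: "XO (l + 1) * XO l = nu_pow 2 *\<^sub>\<nu> (XO l * XO (l + 1))"
proof -
  have top: "X (- l - 2, 1) * X (- l - 1, 1) = nu_pow 2 *\<^sub>\<nu> (X (- l - 1, 1) * X (- l - 2, 1))"
    by (simp add: X_mult Lam_def nu_pow_mult algebra_simps)
  have mid: "X (- l - 2, 1) * XO_low l + XO_low (l + 1) * X (- l - 1, 1)
      = nu_pow 2 *\<^sub>\<nu> (X (- l - 1, 1) * XO_low (l + 1) + XO_low l * X (- l - 2, 1))"
  proof (rule qtorus_eqI)
    fix \<gamma> :: expo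
    obtain a b where \<gamma>: "\<gamma> = (a, b)" by (cases \<gamma>)
    show "coeff (X (- l - 2, 1) * XO_low l + XO_low (l + 1) * X (- l - 1, 1)) \<gamma>
      = coeff (nu_pow 2 *\<^sub>\<nu> (X (- l - 1, 1) * XO_low (l + 1) + XO_low l * X (- l - 2, 1))) \<gamma>"
    proof (cases "b = 0 \<and> odd a")
      case True
      then have "a = - 1 - 2 * ((- 1 - a) div 2)" by presburger
      then obtain t where t: "a = - 1 - 2 * t" by blast
      show ?thesis
        using True sqint_commutation[of t]
        by (simp add: \<gamma> t coeff_X_mult coeff_mult_X coeff_XO_low Lam_def algebra_simps)
    next
      case False
      then show ?thesis
        by (auto simp: \<gamma> coeff_X_mult coeff_mult_X coeff_XO_low Lam_def)
    qed
  qed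
  have eqs: "XO l = X (- l - 1, 1) + XO_low l" "XO (l + 1) = X (- l - 2, 1) + XO_low (l + 1)"
    by (simp_all add: XO_low_def algebra_simps)
  have "XO (l + 1) * XO l = X (- l - 2, 1) * X (- l - 1, 1)
      + (X (- l - 2, 1) * XO_low l + XO_low (l + 1) * X (- l - 1, 1)) + XO_low (l + 1) * XO_low l"
    unfolding eqs by (simp only: distrib_left distrib_right add_ac)
  also have "\<dots> = nu_pow 2 *\<^sub>\<nu> (XO l * XO (l + 1))"
    unfolding top mid XO_low_commute eqs
    by (simp only: distrib_left distrib_right qtorus.scale_right_distrib add_ac)
  finally show ?thesis .
qed

text \<open>The same splitting; the constant 1 is the product of the top monomial X^(-l, 1) of
  \<open>XO (l - 1)\<close> with the first tail term X^(l, -1) of \<open>XO (l + 1)\<close>.\<close>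

lemma XO_exchange: "XO (l - 1) * XO (l + 1) = nu_pow (- 2) *\<^sub>\<nu> (XO l * XO l) + 1"
proof -
  have top: "X (- l, 1) * X (- l - 2, 1) = nu_pow (- 2) *\<^sub>\<nu> (X (- l - 1, 1) * X (- l - 1, 1))"
    by (simp add: X_mult Lam_def nu_pow_mult algebra_simps)
  have mid: "X (- l, 1) * XO_low (l + 1) + XO_low (l - 1) * X (- l - 2, 1)
      = nu_pow (- 2) *\<^sub>\<nu> (X (- l - 1, 1) * XO_low l + XO_low l * X (- l - 1, 1)) + 1"
  proof (rule qtorus_eqI)
    fix \<gamma> :: expo
    obtain a b where \<gamma>: "\<gamma> = (a, b)" by (cases \<gamma>)
    show "coeff (X (- l, 1) * XO_low (l + 1) + XO_low (l - 1) * X (- l - 2, 1)) \<gamma>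
      = coeff (nu_pow (- 2) *\<^sub>\<nu> (X (- l - 1, 1) * XO_low l + XO_low l * X (- l - 1, 1)) + 1) \<gamma>"
    proof (cases "b = 0 \<and> even a")
      case True
      then have "a = - 2 * (- a div 2)" by presburger
      then obtain t where t: "a = - 2 * t" by blast
      show ?thesis
        using True sqint_exchange[of t]
        by (auto simp: \<gamma> t coeff_X_mult coeff_mult_X coeff_XO_low Lam_def algebra_simps
            one_qtorus.rep_eq zero_prod_def)
    next
      case False
      then show ?thesis
        by (auto simp: \<gamma> coeff_X_mult coeff_mult_X coeff_XO_low Lam_def
            one_qtorus.rep_eq zero_prod_def)
    qed
  qed
  have eqs: "XO l = X (- l - 1, 1) + XO_low l" "XO (l + 1) = X (- l - 2, 1) + XO_low (l + 1)"
    "XO (l - 1) = X (- l, 1) + XO_low (l - 1)"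
    by (simp_all add: XO_low_def algebra_simps)
  have "XO (l - 1) * XO (l + 1) = X (- l, 1) * X (- l - 2, 1)
      + (X (- l, 1) * XO_low (l + 1) + XO_low (l - 1) * X (- l - 2, 1)) + XO_low (l - 1) * XO_low (l + 1)"
    unfolding eqs by (simp only: distrib_left distrib_right add_ac)
  also have "\<dots> = nu_pow (- 2) *\<^sub>\<nu> (XO l * XO l) + 1"
    unfolding top mid XO_low_exchange eqs
    by (simp only: distrib_left distrib_right qtorus.scale_right_distrib add_ac)
  finally show ?thesis .
qed

text \<open>The index is raised by \<open>X (- 1, 0)\<close> on the top monomial but by
  \<open>X (1, 0)\<close> on the tail; the opposite second coordinates give both the factor
  \<nu>.\<close>

lemma delta_XO: "\<delta> * XO l = nu_pow (- 1) *\<^sub>\<nu> XO (l - 1) + nu_pow 1 *\<^sub>\<nu> XO (l + 1)"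
proof (rule qtorus_eqI)
  fix \<gamma> :: expo
  obtain a b where \<gamma>: "\<gamma> = (a, b)" by (cases \<gamma>)
  define p where "p s = (if even s then sqint (s div 2) else 0)" for s
  have XO: "coeff (XO k) (c, d) = (if d = 1 \<and> c = - k - 1 then 1 else 0)
      + (if d = - 1 then p (k - 1 - c) else 0)" for k c d
    by (auto simp: XO_split coeff_XO_low X.rep_eq p_def)
  have "coeff (\<delta> * XO l) (a, b)
      = nu_pow b * coeff (XO l) (a + 1, b) + nu_pow (- b) * coeff (XO l) (a - 1, b)"
    by (simp add: \<delta>_def distrib_right coeff_X_mult Lam_def)
  also have "\<dots> = nu_pow (- 1) * coeff (XO (l - 1)) (a, b) + nu_pow 1 * coeff (XO (l + 1)) (a, b)"
  proof -
    consider "b = 1" | "b = - 1" | "b \<noteq> 1" "b \<noteq> - 1" by blast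
    then show ?thesis
    proof cases
      case 1
      have "(a + 1 = - l - 1) = (a = - l - 2)" "(a - 1 = - l - 1) = (a = - l)" by auto
      with 1 show ?thesis by (simp add: XO algebra_simps)
    next
      case 2
      have "l - 1 - (a + 1) = l - 1 - 1 - a" "l - 1 - (a - 1) = l + 1 - 1 - a" by auto
      with 2 show ?thesis by (simp only: XO) simp
    qed (simp add: XO)
  qed
  finally show "coeff (\<delta> * XO l) \<gamma>
      = coeff (nu_pow (- 1) *\<^sub>\<nu> XO (l - 1) + nu_pow 1 *\<^sub>\<nu> XO (l + 1)) \<gamma>"
    by (simp add: \<gamma>)
qed

text \<open>The bar-involution reverses the product and inverts \<nu> in
  \<open>delta_XO\<close>.\<close>

lemma XO_delta: "XO l * \<delta> = nu_pow 1 *\<^sub>\<nu> XO (l - 1) + nu_pow (- 1) *\<^sub>\<nu> XO (l + 1)"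
  using arg_cong[OF delta_XO, of bar l] by (simp add: bar_mult bar_add bar_qscale)

lemma XO_Suc: "XO (l + 1) = nu_pow (- 1) *\<^sub>\<nu> (\<delta> * XO l) - nu_pow (- 2) *\<^sub>\<nu> XO (l - 1)"
  by (simp add: delta_XO qtorus.scale_right_distrib nu_pow_mult)

lemma XO_pred: "XO (l - 1) = nu_pow 1 *\<^sub>\<nu> (\<delta> * XO l) - nu_pow 2 *\<^sub>\<nu> XO (l + 1)"
  by (simp add: delta_XO qtorus.scale_right_distrib nu_pow_mult)

section \<open>Membership of \<open>\<delta>\<close> in the cluster algebra\<close>

lemma subspace_cluster_algebra: "qtorus.subspace cluster_algebra"
  and cluster_algebra_one: "1 \<in> cluster_algebra"
  and cluster_algebra_mult:
    "f \<in> cluster_algebra \<Longrightarrow> g \<in> cluster_algebra \<Longrightarrow> f * g \<in> cluster_algebra"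
  using subalgebra_cluster_algebra by (auto simp: subalgebra_def)

lemma XO_in_cluster_algebra: "XO l \<in> cluster_algebra"
  unfolding cluster_algebra_def by (rule hull_inc) simp

text \<open>\<open>XO 3\<close> is expanded through \<open>XO 2 * \<delta>\<close>. The constant 1
  in the exchange relation for \<open>XO 0 * XO 2\<close> isolates \<delta>, and the multiples of
  \<open>XO 0 * XO 1\<close> cancel.\<close>

lemma delta_in_cluster_algebra: "\<delta> \<in> cluster_algebra"
proof -
  have "XO 0 * XO 3 = nu_pow 1 *\<^sub>\<nu> (XO 0 * XO 2 * \<delta>) - nu_pow 2 *\<^sub>\<nu> (XO 0 * XO 1)"
    using XO_delta[of 2]
    by (simp add: mult.assoc distrib_left qtorus.scale_right_distrib qscale_mult_right nu_pow_mult)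
  also have "XO 0 * XO 2 = nu_pow (- 2) *\<^sub>\<nu> (XO 1 * XO 1) + 1"
    using XO_exchange[of 1] by simp
  also have "(nu_pow (- 2) *\<^sub>\<nu> (XO 1 * XO 1) + 1) * \<delta>
      = nu_pow (- 2) *\<^sub>\<nu> (XO 1 * (XO 1 * \<delta>)) + \<delta>"
    by (simp add: distrib_right qscale_mult_left mult.assoc)
  also have "XO 1 * (XO 1 * \<delta>) = nu_pow 3 *\<^sub>\<nu> (XO 0 * XO 1) + nu_pow (- 1) *\<^sub>\<nu> (XO 1 * XO 2)"
    using XO_delta[of 1] XO_commute[of 0]
    by (simp add: distrib_left qscale_mult_right nu_pow_mult)
  finally have "\<delta> = nu_pow (- 1) *\<^sub>\<nu> (XO 0 * XO 3 - nu_pow (- 2) *\<^sub>\<nu> (XO 1 * XO 2))"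
    by (simp add: qtorus.scale_right_distrib qtorus.scale_right_diff_distrib nu_pow_mult)
  moreover have "nu_pow (- 1) *\<^sub>\<nu> (XO 0 * XO 3 - nu_pow (- 2) *\<^sub>\<nu> (XO 1 * XO 2)) \<in> cluster_algebra"
    by (intro qtorus.subspace_scale qtorus.subspace_diff subspace_cluster_algebra
        cluster_algebra_mult XO_in_cluster_algebra)
  ultimately show ?thesis by (rule ssubst)
qed

section \<open>Powers of generators and cluster monomials\<close>

lemma power_quasi_commute:
  assumes "y * x = nu_pow c *\<^sub>\<nu> (x * y)"
  shows "y ^ m * x ^ n = nu_pow (c * int m * int n) *\<^sub>\<nu> (x ^ n * y ^ m)"
proof -
  have right: "y * x ^ n = nu_pow (c * int n) *\<^sub>\<nu> (x ^ n * y)" for n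
  proof (induction n)
    case (Suc n)
    have "y * x ^ Suc n = (y * x) * x ^ n"
      by (simp add: mult.assoc)
    also have "\<dots> = nu_pow c *\<^sub>\<nu> (x * (y * x ^ n))"
      by (simp add: assms qscale_mult_left mult.assoc)
    also have "\<dots> = nu_pow (c * int (Suc n)) *\<^sub>\<nu> (x ^ Suc n * y)"
      by (simp add: Suc qscale_mult_right mult.assoc nu_pow_mult distrib_left)
    finally show ?case .
  qed simp
  show ?thesis
  proof (induction m)
    case (Suc m)
    have "y ^ Suc m * x ^ n = y * (y ^ m * x ^ n)"
      by (simp add: mult.assoc)
    also have "\<dots> = nu_pow (c * int m * int n) *\<^sub>\<nu> ((y * x ^ n) * y ^ m)"
      by (simp add: Suc qscale_mult_right mult.assoc)
    also have "\<dots> = nu_pow (c * int (Suc m) * int n) *\<^sub>\<nu> (x ^ n * y ^ Suc m)"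
      by (simp add: right qscale_mult_left mult.assoc nu_pow_mult algebra_simps)
    finally show ?case .
  qed simp
qed

lemmas XO_power_commute = power_quasi_commute[OF XO_commute]

text \<open>The total degree \<open>r\<close> is traded for \<open>e = r - d\<close>. The condition
  \<open>1 \<le> d\<close> keeps a power of a single generator from appearing under two indices
  \<open>l\<close>.\<close>

lemma B_vet_eq:
  "B_vet = {nu_pow (int (d * e)) *\<^sub>\<nu> (XO l ^ d * XO (l + 1) ^ e) | l d e. 1 \<le> d}"
  (is "_ = ?R")
proof
  show "B_vet \<subseteq> ?R"
    unfolding B_vet_def by blast
  show "?R \<subseteq> B_vet"
  proof
    fix f assume "f \<in> ?R"
    then obtain l d e where f: "f = nu_pow (int (d * e)) *\<^sub>\<nu> (XO l ^ d * XO (l + 1) ^ e)"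
      and d: "1 \<le> d" by blast
    then have "f = nu_pow (int (d * (d + e - d))) *\<^sub>\<nu> (XO l ^ d * XO (l + 1) ^ (d + e - d))" by simp
    then have "f \<in> {nu_pow (int (d' * (d + e - d'))) *\<^sub>\<nu> (XO l ^ d' * XO (l + 1) ^ (d + e - d'))
        | l d'. 1 \<le> d' \<and> d' \<le> d + e}"
      using d le_add1[of d e] by blast
    then show "f \<in> B_vet"
      unfolding B_vet_def by (rule UN_I[rotated]) (use d in simp)
  qed
qed

section \<open>Leading exponents\<close>

text \<open>Exponents are ordered lexicographically, the second coordinate first.\<close>

definition leading :: "qtorus \<Rightarrow> laurent \<Rightarrow> expo \<Rightarrow> bool"
  where "leading f u \<alpha> \<longleftrightarrow> coeff f \<alpha> = u \<and> (\<forall>\<gamma>. coeff f \<gamma> \<noteq> 0 \<longrightarrow> prod.swap \<gamma> \<le> prod.swap \<alpha>)"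

lemma leading_unique:
  assumes "leading f 1 \<alpha>" "leading f 1 \<beta>"
  shows "\<alpha> = \<beta>"
proof -
  have "coeff f \<alpha> \<noteq> 0" "coeff f \<beta> \<noteq> 0"
    using assms by (simp_all add: leading_def)
  then have "prod.swap \<alpha> \<le> prod.swap \<beta>" "prod.swap \<beta> \<le> prod.swap \<alpha>"
    using assms unfolding leading_def by blast+
  then show ?thesis
    by (metis order_antisym swap_swap)
qed

lemma leading_scale: "leading f u \<alpha> \<Longrightarrow> leading (c *\<^sub>\<nu> f) (c * u) \<alpha>"
  by (auto simp: leading_def)

lemma leading_diff:
  assumes "leading f u \<alpha>" "leading g v \<beta>" "prod.swap \<beta> < prod.swap \<alpha>"
  shows "leading (f - g) u \<alpha>"
proof -
  have "coeff g \<alpha> = 0"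
    using assms unfolding leading_def by (metis leD)
  moreover have "prod.swap \<gamma> \<le> prod.swap \<alpha>" if "coeff (f - g) \<gamma> \<noteq> 0" for \<gamma>
  proof -
    from that have "coeff f \<gamma> \<noteq> 0 \<or> coeff g \<gamma> \<noteq> 0" by auto
    then have "prod.swap \<gamma> \<le> prod.swap \<alpha> \<or> prod.swap \<gamma> \<le> prod.swap \<beta>"
      using assms unfolding leading_def by blast
    then show ?thesis using assms(3) by auto
  qed
  ultimately show ?thesis
    using assms(1) unfolding leading_def by simp
qed

text \<open>Addition is strictly monotone for the lexicographic order, so only the pair of leading
  exponents contributes to their sum.\<close>

lemma leading_mult:
  assumes f: "leading f u \<alpha>" and g: "leading g v \<beta>"
  shows "leading (f * g) (nu_pow (Lam \<alpha> \<beta>) * u * v) (\<alpha> + \<beta>)"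
  unfolding leading_def
proof (intro conjI allI impI)
  let ?P = "\<lambda>\<gamma>. {(\<mu>, \<kappa>). \<mu> + \<kappa> = \<gamma> \<and> coeff f \<mu> \<noteq> 0 \<and> coeff g \<kappa> \<noteq> 0}"
  have "?P (\<alpha> + \<beta>) \<subseteq> {(\<alpha>, \<beta>)}"
  proof (clarify)
    fix a b c d
    assume *: "(a, b) + (c, d) = \<alpha> + \<beta>" "coeff f (a, b) \<noteq> 0" "coeff g (c, d) \<noteq> 0"
    have "prod.swap (a, b) \<le> prod.swap \<alpha>" "prod.swap (c, d) \<le> prod.swap \<beta>"
      using f g * unfolding leading_def by blast+
    with * have "(a, b) = \<alpha> \<and> (c, d) = \<beta>"
      by (cases \<alpha>; cases \<beta>) (auto simp: less_eq_prod_def)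
    then show "(a, b) = \<alpha> \<and> (c, d) = \<beta>" .
  qed
  then have "coeff (f * g) (\<alpha> + \<beta>)
      = (\<Sum>(\<mu>, \<kappa>)\<in>{(\<alpha>, \<beta>)}. nu_pow (Lam \<mu> \<kappa>) * coeff f \<mu> * coeff g \<kappa>)"
    unfolding times_qtorus.rep_eq qmult_def by (intro sum.mono_neutral_left) auto
  then show "coeff (f * g) (\<alpha> + \<beta>) = nu_pow (Lam \<alpha> \<beta>) * u * v"
    using f g by (simp add: leading_def)
  fix \<gamma> assume nz: "coeff (f * g) \<gamma> \<noteq> 0"
  have "?P \<gamma> \<noteq> {}"
  proof
    assume "?P \<gamma> = {}"
    then have "coeff (f * g) \<gamma> = 0"
      unfolding times_qtorus.rep_eq qmult_def by (simp only: sum.empty)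
    with nz show False ..
  qed
  then obtain \<mu> \<kappa> where *: "\<gamma> = \<mu> + \<kappa>" "coeff f \<mu> \<noteq> 0" "coeff g \<kappa> \<noteq> 0" by blast
  then have "prod.swap \<mu> \<le> prod.swap \<alpha>" "prod.swap \<kappa> \<le> prod.swap \<beta>"
    using f g unfolding leading_def by blast+
  then show "prod.swap \<gamma> \<le> prod.swap (\<alpha> + \<beta>)"
    unfolding * by (auto simp: less_eq_prod_def)
qed

lemma leading_one: "leading 1 1 0"
  by (auto simp: leading_def one_qtorus.rep_eq zero_prod_def split: if_splits)

lemma leading_power:
  assumes "leading f 1 (a, b)"
  shows "leading (f ^ n) 1 (int n * a, int n * b)"
proof (induction n)
  case (Suc n)
  show ?case
    using leading_mult[OF assms Suc] by (simp add: Lam_def algebra_simps)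
qed (use leading_one in \<open>simp add: zero_prod_def\<close>)

lemma leading_delta: "leading \<delta> 1 (1, 0)"
  by (auto simp: leading_def \<delta>_def X.rep_eq less_eq_prod_def split: if_splits)

lemma leading_XO: "leading (XO l) 1 (- l - 1, 1)"
  by (auto simp: leading_def XO_split X.rep_eq coeff_XO_low less_eq_prod_def split: if_splits)

text \<open>The prefactor \<nu>^(de) cancels the twist \<nu>^(-de) between the leading
  monomials.\<close>

lemma leading_cluster_monomial:
  "leading (nu_pow (int (d * e)) *\<^sub>\<nu> (XO l ^ d * XO (l + 1) ^ e)) 1
    (- (l + 1) * int (d + e) - int e, int (d + e))"
proof -
  let ?k = "Lam (int d * (- l - 1), int d * 1) (int e * (- (l + 1) - 1), int e * 1)"
  have k: "?k = - int (d * e)"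
    by (simp add: Lam_def algebra_simps)
  have "(int d * (- l - 1), int d * 1) + (int e * (- (l + 1) - 1), int e * 1)
      = (- (l + 1) * int (d + e) - int e, int (d + e))"
    by (simp add: algebra_simps)
  moreover have "nu_pow (int (d * e)) * (nu_pow ?k * 1 * 1) = 1"
    unfolding k by (simp add: nu_pow_mult)
  ultimately show ?thesis
    using leading_scale[OF leading_mult[OF leading_power[OF leading_XO[of l], of d]
          leading_power[OF leading_XO[of "l + 1"], of e]], of "nu_pow (int (d * e))"]
    by metis
qed

text \<open>In a nontrivial relation the largest leading exponent occurs in exactly one term, whose
  coefficient would then vanish.\<close>

lemma independent_if_leading:
  assumes ex: "\<And>b. b \<in> S \<Longrightarrow> \<exists>\<alpha>. leading b 1 \<alpha>"
    and inj: "\<And>b b' \<alpha>. b \<in> S \<Longrightarrow> b' \<in> S \<Longrightarrow> leading b 1 \<alpha> \<Longrightarrow> leading b' 1 \<alpha> \<Longrightarrow> b = b'"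
  shows "qtorus.independent S"
proof
  assume "qtorus.dependent S"
  then obtain T u where T: "finite T" "T \<subseteq> S" "(\<Sum>b\<in>T. u b *\<^sub>\<nu> b) = 0" and "\<exists>b\<in>T. u b \<noteq> 0"
    unfolding qtorus.dependent_explicit by blast
  obtain a where a: "\<And>b. b \<in> S \<Longrightarrow> leading b 1 (a b)"
    using ex by metis
  let ?T = "{b \<in> T. u b \<noteq> 0}"
  let ?M = "Max ((\<lambda>b. prod.swap (a b)) ` ?T)"
  have "?M \<in> (\<lambda>b. prod.swap (a b)) ` ?T"
    using \<open>finite T\<close> \<open>\<exists>b\<in>T. u b \<noteq> 0\<close> by (intro Max_in) auto
  then obtain m where m: "m \<in> T" "u m \<noteq> 0" "?M = prod.swap (a m)"
    by auto
  have max: "prod.swap (a b) \<le> prod.swap (a m)" if "b \<in> T" "u b \<noteq> 0" for b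
    unfolding m(3)[symmetric] using \<open>finite T\<close> that by (intro Max_ge) auto
  have other: "u b * coeff b (a m) = 0" if "b \<in> T - {m}" for b
  proof (rule ccontr)
    assume "u b * coeff b (a m) \<noteq> 0"
    then have "u b \<noteq> 0" "coeff b (a m) \<noteq> 0" by auto
    moreover have "b \<in> S" "m \<in> S" using that m T by auto
    ultimately have "prod.swap (a m) = prod.swap (a b)"
      using that max[of b] a[of b] unfolding leading_def by (metis DiffE order_antisym)
    then have "a m = a b"
      by (metis swap_swap)
    then have "b = m"
      using inj[of b m "a m"] a \<open>b \<in> S\<close> \<open>m \<in> S\<close> by metis
    then show False using that by simp
  qed
  have "0 = coeff (\<Sum>b\<in>T. u b *\<^sub>\<nu> b) (a m)"
    by (simp add: T)
  also have "\<dots> = u m * coeff m (a m) + (\<Sum>b\<in>T - {m}. u b * coeff b (a m))"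
    using sum.remove[OF T(1) m(1), of "\<lambda>b. u b * coeff b (a m)"] by (simp add: coeff_sum)
  also have "\<dots> = u m"
    using a[of m] m T by (auto simp: other leading_def)
  finally show False using m by simp
qed

section \<open>The three bases\<close>

text \<open>All three families of elements of the tube satisfy a Chebyshev-type recursion; the choices are
  \<open>k 0 = 2\<close> and \<open>k n = 1\<close> otherwise (first kind), \<open>k = 1\<close> (second kind), and \<open>k = 0\<close> (powers).\<close>

locale torus_family =
  fixes t :: "nat \<Rightarrow> qtorus" and k :: "nat \<Rightarrow> laurent"
  assumes t_0 [simp]: "t 0 = 1"
    and t_1 [simp]: "t (Suc 0) = \<delta>"
    and t_rec [simp]: "t (Suc (Suc n)) = \<delta> * t (Suc n) - k n *\<^sub>\<nu> t n"
    and bar_k: "laurent_bar (k n) = k n"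
begin

abbreviation N :: "qtorus set"
  where "N \<equiv> qtorus.span (range t \<union> B_vet)"

text \<open>The subtracted term lies lexicographically lower. \<open>leading\<close> permits a zero
  coefficient, which covers \<open>k n = 0\<close>.\<close>

lemma leading_t: "leading (t n) 1 (int n, 0)"
proof (induction n rule: induct_nat_012)
  case 0
  then show ?case using leading_one by (simp add: zero_prod_def)
next
  case 1
  then show ?case using leading_delta by simp
next
  case (ge2 n)
  have "leading (\<delta> * t (Suc n)) 1 (int (Suc (Suc n)), 0)"
    using leading_mult[OF leading_delta ge2(2)] by (simp add: Lam_def add.commute)
  then show ?case
    using leading_diff[OF _ leading_scale[OF ge2(1), of "k n"]] by (simp add: less_prod_def)
qed

lemma delta_commute_t: "\<delta> * t n = t n * \<delta>"
  by (induction n rule: induct_nat_012)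
    (simp_all add: algebra_simps qscale_mult_left qscale_mult_right, metis mult.assoc)

lemma bar_t: "bar (t n) = t n"
proof (induction n rule: induct_nat_012)
  case (ge2 n)
  have "bar (t (Suc (Suc n))) = bar (\<delta> * t (Suc n)) - bar (k n *\<^sub>\<nu> t n)"
    unfolding t_rec by (metis add_diff_cancel_right' diff_add_cancel bar_add)
  then show ?case
    using ge2 by (simp add: bar_mult bar_qscale bar_k delta_commute_t)
qed (simp_all add: bar_one)

text \<open>Bar sends \<nu>^(de) to \<nu>^(-de) and reverses the two powers; restoring their order
  contributes \<nu>^(2de).\<close>

lemma bar_basis: "x \<in> range t \<union> B_vet \<Longrightarrow> bar x = x"
  by (auto simp: bar_t B_vet_eq bar_qscale bar_mult bar_power XO_power_commute nu_pow_mult algebra_simps)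

text \<open>Second coordinate 0 singles out the \<open>t n\<close>; a positive one is the degree
  \<open>r\<close>, and dividing the negated first coordinate by \<open>r\<close> recovers
  \<open>l\<close> and \<open>e\<close>.\<close>

lemma independent_basis: "qtorus.independent (range t \<union> B_vet)"
proof (rule independent_if_leading)
  have cases: "(\<exists>n. b = t n \<and> \<alpha> = (int n, 0)) \<or>
      (\<exists>l d e. b = nu_pow (int (d * e)) *\<^sub>\<nu> (XO l ^ d * XO (l + 1) ^ e) \<and> 1 \<le> d
        \<and> \<alpha> = (- (l + 1) * int (d + e) - int e, int (d + e)))"
    if "b \<in> range t \<union> B_vet" "leading b 1 \<alpha>" for b \<alpha>
    using that(1)
  proof
    assume "b \<in> B_vet"
    then obtain l d e where "b = nu_pow (int (d * e)) *\<^sub>\<nu> (XO l ^ d * XO (l + 1) ^ e)" "1 \<le> d"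
      unfolding B_vet_eq by blast
    with that(2) show ?thesis
      using leading_unique leading_cluster_monomial by blast
  qed (use that(2) leading_unique leading_t in blast)
  fix b b' \<alpha>
  assume in_S: "b \<in> range t \<union> B_vet" "b' \<in> range t \<union> B_vet"
    and lead: "leading b 1 \<alpha>" "leading b' 1 \<alpha>"
  show "b = b'"
    using cases[OF in_S(1) lead(1)]
  proof (elim disjE exE conjE)
    fix n assume b: "b = t n" and \<alpha>: "\<alpha> = (int n, 0)"
    show ?thesis
      using cases[OF in_S(2) lead(2)]
    proof (elim disjE exE conjE)
      fix n' assume "b' = t n'" "\<alpha> = (int n', 0)"
      with b \<alpha> show ?thesis by simp
    next
      fix l :: int and d e :: nat
      assume "1 \<le> d" "\<alpha> = (- (l + 1) * int (d + e) - int e, int (d + e))"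
      with \<alpha> show ?thesis by simp
    qed
  next
    fix l d e
    assume b: "b = nu_pow (int (d * e)) *\<^sub>\<nu> (XO l ^ d * XO (l + 1) ^ e)" and d: "1 \<le> d"
      and \<alpha>: "\<alpha> = (- (l + 1) * int (d + e) - int e, int (d + e))"
    show ?thesis
      using cases[OF in_S(2) lead(2)]
    proof (elim disjE exE conjE)
      fix n' assume "\<alpha> = (int n', 0)"
      with \<alpha> d show ?thesis by simp
    next
      fix l' d' e'
      assume b': "b' = nu_pow (int (d' * e')) *\<^sub>\<nu> (XO l' ^ d' * XO (l' + 1) ^ e')"
        and d': "1 \<le> d'" and \<alpha>': "\<alpha> = (- (l' + 1) * int (d' + e') - int e', int (d' + e'))"
      define r where "r = int (d + e)"
      have r: "r = int (d' + e')"
        using \<alpha> \<alpha>' by (simp add: r_def)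
      have "- (l + 1) * r - int e = - (l' + 1) * r - int e'"
        using \<alpha>[folded r_def] \<alpha>'[folded r] by (simp only: prod.inject)
      then have eq: "(l + 1) * r + int e = (l' + 1) * r + int e'"
        by (simp add: algebra_simps)
      \<comment> \<open>Since \<open>1 \<le> d\<close>, \<open>e < r\<close> holds, so
        \<open>e\<close> is the remainder and \<open>l + 1\<close> the quotient.\<close>
      have quot: "(j * r + i) div r = j" if "0 \<le> i" "i < r" for i j
        using that by (simp add: div_pos_pos_trivial)
      have "int e < r" "int e' < r"
        using d d' r by (simp_all add: r_def)
      then have "l + 1 = l' + 1"
        using quot[of "int e" "l + 1"] quot[of "int e'" "l' + 1"] eq by simp
      then have "l = l'" "e = e'" using eq by simp_all
      moreover have "d = d'" using r \<open>e = e'\<close> by (simp add: r_def)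
      ultimately show ?thesis using b b' by simp
    qed
  qed
qed (unfold B_vet_eq, blast intro: leading_t leading_cluster_monomial)

section \<open>Stability of the span under the generators\<close>

lemma t_in_N: "t n \<in> N"
  by (rule qtorus.span_base) simp

lemma nu_pow_scale_in_N: "nu_pow j *\<^sub>\<nu> f \<in> N \<longleftrightarrow> f \<in> N"
  using qtorus.span_scale[of "nu_pow j *\<^sub>\<nu> f" _ "nu_pow (- j)"] qtorus.span_scale[of f]
  by (auto simp: nu_pow_mult)

lemma cluster_monomial_in_N: "XO l ^ d * XO (l + 1) ^ e \<in> N"
proof -
  have pos: "XO l ^ d * XO (l + 1) ^ e \<in> N" if "d \<ge> 1" for l d e
    using nu_pow_scale_in_N[of "int (d * e)"] qtorus.span_base[of _ "range t \<union> B_vet"] that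
    unfolding B_vet_eq by blast
  show ?thesis
  proof (cases "d = 0")
    case True
    \<comment> \<open>A power of \<open>XO (l + 1)\<close> alone is a monomial of index
      \<open>l + 1\<close>; the empty one is \<open>t 0\<close>.\<close>
    then show ?thesis
      using pos[of e "l + 1" 0] t_in_N[of 0] by (cases "e = 0") auto
  qed (use pos in simp)
qed

lemma XO_in_N: "XO l \<in> N"
  using cluster_monomial_in_N[of l 1 0] by simp

text \<open>\<open>XO_delta\<close> absorbs one \<delta> at the cost of shifting \<open>m\<close> by
  one, hence the induction with arbitrary \<open>m\<close>.\<close>

lemma XO_mult_t_in_N: "XO m * t n \<in> N"
proof (induction n arbitrary: m rule: induct_nat_012)
  case (ge2 n)
  have "XO m * t (Suc (Suc n)) = nu_pow 1 *\<^sub>\<nu> (XO (m - 1) * t (Suc n))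
      + nu_pow (- 1) *\<^sub>\<nu> (XO (m + 1) * t (Suc n)) - k n *\<^sub>\<nu> (XO m * t n)"
    by (simp add: right_diff_distrib XO_delta distrib_right qscale_mult_left qscale_mult_right
        flip: mult.assoc)
  then show ?case
    using ge2 by (auto intro!: qtorus.span_diff qtorus.span_add qtorus.span_scale)
qed (auto simp: XO_delta intro!: XO_in_N qtorus.span_add qtorus.span_scale)

lemma XO_succ_mult_in_N: "XO (l + 1) * (XO l ^ d * XO (l + 1) ^ e) \<in> N"
proof -
  have "XO (l + 1) * (XO l ^ d * XO (l + 1) ^ e)
      = nu_pow (2 * int d) *\<^sub>\<nu> (XO l ^ d * XO (l + 1) ^ Suc e)"
    using XO_power_commute[of l 1 d] by (simp add: qscale_mult_left flip: mult.assoc)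
  then show ?thesis
    by (simp only: nu_pow_scale_in_N cluster_monomial_in_N)
qed

text \<open>If \<open>e > 0\<close>, \<open>XO (l - 1)\<close> is moved through the power of
  \<open>XO l\<close> until it meets \<open>XO (l + 1)\<close>, where the exchange relation
  eliminates both.\<close>

lemma XO_pred_mult_in_N: "XO (l - 1) * (XO l ^ d * XO (l + 1) ^ e) \<in> N"
proof (cases e)
  case 0
  then show ?thesis
    using cluster_monomial_in_N[of "l - 1" 1 d] by simp
next
  case (Suc e')
  have comm: "XO (l - 1) * XO l ^ d = nu_pow (- 2 * int d) *\<^sub>\<nu> (XO l ^ d * XO (l - 1))"
    using XO_power_commute[of "l - 1" d 1] by (simp add: nu_pow_mult)
  have "XO (l - 1) * (XO l ^ d * XO (l + 1) ^ e)
      = nu_pow (- 2 * int d) *\<^sub>\<nu> (XO l ^ d * (XO (l - 1) * XO (l + 1)) * XO (l + 1) ^ e')"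
    unfolding Suc mult.assoc[symmetric] comm by (simp add: qscale_mult_left mult.assoc)
  also have "XO l ^ d * (XO (l - 1) * XO (l + 1)) * XO (l + 1) ^ e'
      = nu_pow (- 2) *\<^sub>\<nu> (XO l ^ (d + 2) * XO (l + 1) ^ e') + XO l ^ d * XO (l + 1) ^ e'"
    unfolding XO_exchange power_add power2_eq_square
    by (simp add: distrib_left distrib_right qscale_mult_left qscale_mult_right mult.assoc)
  finally show ?thesis
    by (auto simp only: intro!: qtorus.span_scale qtorus.span_add cluster_monomial_in_N)
qed

lemma mult_closed_N:
  assumes "\<And>n. g * t n \<in> N" and "\<And>l d e. g * (XO l ^ Suc d * XO (l + 1) ^ e) \<in> N"
    and "f \<in> N"
  shows "g * f \<in> N"
  using assms(3)
proof (induction rule: qtorus.span_induct)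
  case base
  show ?case
    unfolding qtorus.subspace_def
    by (auto simp: distrib_left qscale_mult_right
        intro: qtorus.span_zero qtorus.span_add qtorus.span_scale)
next
  case (step b)
  then show ?case
  proof
    assume "b \<in> B_vet"
    then obtain l d e where "b = nu_pow (int (d * e)) *\<^sub>\<nu> (XO l ^ d * XO (l + 1) ^ e)" "1 \<le> d"
      unfolding B_vet_eq by blast
    then show ?thesis
      using assms(2)[of l "d - 1" e] by (simp add: qscale_mult_right nu_pow_scale_in_N)
  qed (use assms(1) in auto)
qed

text \<open>The recursion handles the \<open>t n\<close>. In a cluster monomial the first
  \<open>XO l\<close> absorbs \<delta>, leaving a neighbouring generator before a smaller
  monomial.\<close>

lemma delta_mult_in_N: "f \<in> N \<Longrightarrow> \<delta> * f \<in> N"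
proof (rule mult_closed_N)
  fix n
  show "\<delta> * t n \<in> N"
  proof (cases n)
    case 0
    then show ?thesis using t_in_N[of 1] by simp
  next
    case (Suc m)
    then have "\<delta> * t n = t (Suc n) + k m *\<^sub>\<nu> t m" by simp
    then show ?thesis by (metis qtorus.span_add qtorus.span_scale t_in_N)
  qed
next
  fix l d e
  have "\<delta> * (XO l ^ Suc d * XO (l + 1) ^ e)
      = nu_pow (- 1) *\<^sub>\<nu> (XO (l - 1) * (XO l ^ d * XO (l + 1) ^ e))
        + nu_pow 1 *\<^sub>\<nu> (XO (l + 1) * (XO l ^ d * XO (l + 1) ^ e))"
    using delta_XO[of l]
    by (simp add: distrib_right qscale_mult_left flip: mult.assoc)
  then show "\<delta> * (XO l ^ Suc d * XO (l + 1) ^ e) \<in> N"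
    by (simp only:) (intro qtorus.span_add qtorus.span_scale XO_pred_mult_in_N XO_succ_mult_in_N)
qed

text \<open>Two consecutive generators trivially map a cluster monomial into \<open>N\<close>; the recursion
  given by \<open>\<delta>\<close> propagates this to all generators.\<close>

lemma XO_mult_in_N: "f \<in> N \<Longrightarrow> XO m * f \<in> N"
proof (rule mult_closed_N)
  fix l d e
  let ?b = "XO l ^ Suc d * XO (l + 1) ^ e"
  have "XO m * ?b \<in> N \<and> XO (m + 1) * ?b \<in> N"
  proof (induction m rule: int_induct[where k = l])
    case base
    show ?case
      using cluster_monomial_in_N[of l "Suc (Suc d)" e] XO_succ_mult_in_N[of l "Suc d" e]
      by (simp add: mult.assoc)
  next
    case (step1 i)
    have "XO (i + 1 + 1) * ?b = nu_pow (- 1) *\<^sub>\<nu> (\<delta> * (XO (i + 1) * ?b)) - nu_pow (- 2) *\<^sub>\<nu> (XO i * ?b)"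
      unfolding XO_Suc[of "i + 1"] by (simp add: left_diff_distrib qscale_mult_left mult.assoc)
    then show ?case
      using step1 by (metis delta_mult_in_N qtorus.span_diff qtorus.span_scale)
  next
    case (step2 i)
    have "XO (i - 1) * ?b = nu_pow 1 *\<^sub>\<nu> (\<delta> * (XO i * ?b)) - nu_pow 2 *\<^sub>\<nu> (XO (i + 1) * ?b)"
      unfolding XO_pred[of i] by (simp add: left_diff_distrib qscale_mult_left mult.assoc)
    then show ?case
      using step2 by (metis delta_mult_in_N qtorus.span_diff qtorus.span_scale diff_add_cancel)
  qed
  then show "XO m * ?b \<in> N" ..
qed (rule XO_mult_t_in_N)

text \<open>The elements whose left multiplication preserves \<open>N\<close> form a subalgebra
  containing the generators; applied to \<open>1 = t 0\<close> they stay in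
  \<open>N\<close>.\<close>

lemma cluster_algebra_subset_N: "cluster_algebra \<subseteq> N"
proof -
  let ?S = "{a. \<forall>f\<in>N. a * f \<in> N}"
  have "subalgebra ?S"
    unfolding subalgebra_def qtorus.subspace_def
    by (auto simp: distrib_right qscale_mult_left mult.assoc
        intro: qtorus.span_zero qtorus.span_add qtorus.span_scale)
  then have "cluster_algebra \<subseteq> ?S"
    unfolding cluster_algebra_def by (intro hull_minimal) (auto intro: XO_mult_in_N)
  then show ?thesis
    using t_in_N[of 0] by fastforce
qed

lemma N_subset_cluster_algebra: "N \<subseteq> cluster_algebra"
proof (rule qtorus.span_minimal)
  show "qtorus.subspace cluster_algebra"
    by (rule subspace_cluster_algebra)
  have "f ^ n \<in> cluster_algebra" if "f \<in> cluster_algebra" for f n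
    using that by (induction n) (auto intro: cluster_algebra_one cluster_algebra_mult)
  then have "B_vet \<subseteq> cluster_algebra"
    unfolding B_vet_eq
    by (auto intro!: qtorus.subspace_scale subspace_cluster_algebra cluster_algebra_mult
        XO_in_cluster_algebra)
  moreover have "t n \<in> cluster_algebra" for n
    by (induction n rule: induct_nat_012)
      (auto intro!: cluster_algebra_one delta_in_cluster_algebra qtorus.subspace_diff
        qtorus.subspace_scale subspace_cluster_algebra cluster_algebra_mult)
  ultimately show "range t \<union> B_vet \<subseteq> cluster_algebra" by blast
qed

lemma is_basis_cluster_algebra: "is_basis (range t \<union> B_vet) cluster_algebra"
  unfolding is_basis_def
  using independent_basis cluster_algebra_subset_N N_subset_cluster_algebra by blast

end

section \<open>The three tube families as instances of the recursion\<close>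

lemma X_ndelta_1: "X_ndelta 1 = \<delta>"
  by (simp add: X_ndelta_def \<delta>_def)

interpretation T1: torus_family X_ndelta "\<lambda>n. if n = 0 then 2 else 1"
proof
  fix n :: nat
  show "X_ndelta (Suc (Suc n)) = \<delta> * X_ndelta (Suc n) - (if n = 0 then 2 else 1) *\<^sub>\<nu> X_ndelta n"
  proof (cases "n = 0")
    case True
    \<comment> \<open>\<delta>^2 has constant term 2, while \<open>X_ndelta 0\<close> is 1 and not
      the Chebyshev value 2; hence the exceptional \<open>k 0 = 2\<close>.\<close>
    have "(2 :: laurent) *\<^sub>\<nu> (1 :: qtorus) = 1 + 1"
      by (metis one_add_one qtorus.scale_left_distrib qtorus.scale_one)
    then show ?thesis
      using True by (simp add: X_ndelta_def \<delta>_def algebra_simps X_mult Lam_def X_0[unfolded zero_prod_def])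
  next
    case False
    then show ?thesis
      by (simp add: X_ndelta_def \<delta>_def algebra_simps X_mult Lam_def) (rule arg_cong[of _ _ X], simp)
  qed
  show "laurent_bar (if n = 0 then 2 else 1) = (if n = 0 then 2 else 1)"
    using laurent_bar_add[of 1 1] by simp
qed (simp_all add: X_ndelta_def \<delta>_def)

interpretation T2: torus_family "\<lambda>r. \<delta> ^ r" "\<lambda>_. 0"
  by standard simp_all

interpretation T3: torus_family X_E "\<lambda>_. 1"
proof
  fix n :: nat
  let ?X = "\<lambda>j. X (j, 0)"
  have "\<delta> * X_E (Suc n)
      = (\<Sum>l = 0..Suc n. ?X (- (int (Suc (Suc n)) - 2 * int l)))
        + (\<Sum>l = 0..Suc n. ?X (- (int n - 2 * int l)))"
    unfolding X_E_def \<delta>_def distrib_right sum_distrib_left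
    by (simp add: X_mult Lam_def algebra_simps sum.distrib del: sum.cl_ivl_Suc)
  \<comment> \<open>The last term of the second sum, with first coordinate \<open>n + 2\<close>, is
    the one the first sum lacks to be \<open>X_E (Suc (Suc n))\<close>.\<close>
  also have "\<dots> = X_E (Suc (Suc n)) + X_E n"
    by (simp add: X_E_def add.commute)
  finally show "X_E (Suc (Suc n)) = \<delta> * X_E (Suc n) - 1 *\<^sub>\<nu> X_E n"
    by simp
qed (simp_all add: X_E_def \<delta>_def X_0[unfolded zero_prod_def])

theorem theorem4:
  shows "\<forall>S \<in> {B1_tor \<union> B_vet, B2_tor \<union> B_vet, B3_tor \<union> B_vet}.
    is_basis S cluster_algebra \<and> (\<forall>x \<in> S. bar x = x)"
proof -
  have "B1_tor = range X_ndelta" "B2_tor = range (\<lambda>r. \<delta> ^ r)" "B3_tor = range X_E"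
    unfolding B1_tor_def B2_tor_def B3_tor_def X_ndelta_1 by auto
  then show ?thesis
    using T1.is_basis_cluster_algebra T1.bar_basis T2.is_basis_cluster_algebra T2.bar_basis
      T3.is_basis_cluster_algebra T3.bar_basis
    by auto
qed

end
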